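(* Let $I$ be a square-free monomial ideal in $S=k[x_1,\ldots,x_n]$ ($k$ a field), and let $\mathbf{m}_1,\ldots,\mathbf{m}_s$ be a well ordered cover of $I$. Let $1\leq a\leq s-1$ and set $$\mathbf{m}=\mathrm{lcm}(\mathbf{m}_1,\ldots,\mathbf{m}_a)\quad\text{and}\quad\mathbf{m}'=\mathrm{lcm}(\mathbf{m}_{a+1},\ldots,\mathbf{m}_s).$$ Then: 1. $\{\mathbf{m}_1,\ldots,\mathbf{m}_a\}$ is a minimal cover of $I_{[\mathbf{m}]}$. 2. The sequence $\mathbf{m}_{a+1},\ldots,\mathbf{m}_s$ is a well ordered cover of $I_{[\mathbf{m}']}$. 3. $\beta_{s-a,\mathbf{m}'}(S/I)\neq 0$.
   Context: "Generators" of a monomial ideal always means its minimal monomial generators. A set of generators of a square-free monomial ideal $I$ is a cover of $I$ if every variable dividing some generator of $I$ divides some element of the set; it is a minimal cover if no proper subset is a cover. A sequence $\mathbf{m}_1,\ldots,\mathbf{m}_s$ of (distinct) generators of $I$ is a well ordered cover of $I$ if $\{\mathbf{m}_1,\ldots,\mathbf{m}_s\}$ is a minimal cover of $I$ and for every generator $\mathbf{n}\notin\{\mathbf{m}_1,\ldots,\mathbf{m}_s\}$ of $I$ there is an index $1\leq j\leq s-1$ with $\mathbf{m}_j\mid\mathrm{lcm}(\mathbf{n},\mathbf{m}_{j+1},\ldots,\mathbf{m}_s)$. For a square-free monomial $\mathbf{m}$, $I_{[\mathbf{m}]}$ is the ideal generated by those generators of $I$ that divide $\mathbf{m}$. $\beta_{i,\mathbf{m}}(S/I)$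 denotes the multigraded Betti number of $S/I$ over $S$ in homological degree $i$ and multidegree $\mathbf{m}$. *)

theory Defs
  imports
    "HOL-Library.Function_Algebras"
    "HOL-Library.Poly_Mapping"
    "Jordan_Normal_Form.Matrix_Kernel"
begin

text \<open>
  The polynomial ring \<open>k[x\<^sub>i | i \<in> 'n]\<close> is the monoid algebra of \<open>'n \<Rightarrow> nat\<close> over
  \<open>'k\<close>, for a finite type \<open>'n\<close> of variables. Monomials are identified with their exponent
  vectors. On these, the pointwise order \<open>\<le>\<close> is divisibility and the pointwise maximum
  \<open>sup\<close> is the least common multiple.
\<close>

type_synonym 'n mon = "'n \<Rightarrow> nat"
type_synonym ('n, 'k) mpoly = "'n mon \<Rightarrow>\<^sub>0 'k"

definition xpow :: "'n mon \<Rightarrow> ('n, 'k::field) mpoly" where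
  "xpow a = Poly_Mapping.single a 1"

definition mon_lcm :: "'n mon list \<Rightarrow> 'n mon" where
  "mon_lcm as = foldr sup as 0"

definition ideal_of :: "'n mon set \<Rightarrow> ('n, 'k::field) mpoly set" where
  "ideal_of A = module.span (*) (xpow ` A)"

definition squarefree_monomial_ideal :: "('n, 'k::field) mpoly set \<Rightarrow> bool" where
  "squarefree_monomial_ideal I \<longleftrightarrow> (\<exists>A. (\<forall>a\<in>A. \<forall>i. a i \<le> 1) \<and> I = ideal_of A)"

text \<open>The minimal monomial generators are the monomials of \<open>I\<close> minimal under divisibility.\<close>

definition gens :: "('n, 'k::field) mpoly set \<Rightarrow> 'n mon set" where
  "gens I = {a. xpow a \<in> I \<and> (\<forall>b. xpow b \<in> I \<and> b \<le> a \<longrightarrow> b = a)}"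

definition cover :: "('n, 'k::field) mpoly set \<Rightarrow> 'n mon set \<Rightarrow> bool" where
  "cover I C \<longleftrightarrow> C \<subseteq> gens I \<and> (\<forall>i. (\<exists>g\<in>gens I. 0 < g i) \<longrightarrow> (\<exists>c\<in>C. 0 < c i))"

definition minimal_cover :: "('n, 'k::field) mpoly set \<Rightarrow> 'n mon set \<Rightarrow> bool" where
  "minimal_cover I C \<longleftrightarrow> cover I C \<and> (\<forall>C'. C' \<subset> C \<longrightarrow> \<not> cover I C')"

text \<open>List positions start at \<open>0\<close>: \<open>ms ! j\<close> is the generator with index \<open>j + 1\<close>, and
  \<open>drop (j + 1) ms\<close> lists the generators after it.\<close>

definition well_ordered_cover :: "('n, 'k::field) mpoly set \<Rightarrow> 'n mon list \<Rightarrow> bool" where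
  "well_ordered_cover I ms \<longleftrightarrow>
     distinct ms \<and> minimal_cover I (set ms) \<and>
     (\<forall>n \<in> gens I - set ms.
        \<exists>j. j + 1 < length ms \<and> ms ! j \<le> mon_lcm (n # drop (j + 1) ms))"

definition ideal_below :: "('n, 'k::field) mpoly set \<Rightarrow> 'n mon \<Rightarrow> ('n, 'k) mpoly set" where
  "ideal_below I m = ideal_of {g \<in> gens I. g \<le> m}"

text \<open>
  A list \<open>as\<close> of multidegrees stands for the multigraded free module \<open>\<Oplus>\<^sub>p S(-as ! p)\<close>.
  A matrix is a multidegree-preserving map \<open>\<Oplus>\<^sub>q S(-bs ! q) \<rightarrow> \<Oplus>\<^sub>p S(-as ! p)\<close> iff
  its \<open>(p, q)\<close> entry is homogeneous of multidegree \<open>bs ! q - as ! p\<close> (hence zero unless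
  \<open>as ! p\<close> divides \<open>bs ! q\<close>).
\<close>

definition graded_map :: "'n mon list \<Rightarrow> 'n mon list \<Rightarrow> ('n, 'k::field) mpoly mat \<Rightarrow> bool" where
  "graded_map as bs A \<longleftrightarrow>
     A \<in> carrier_mat (length as) (length bs) \<and>
     (\<forall>p < length as. \<forall>q < length bs. \<forall>c \<in> Poly_Mapping.keys (A $$ (p, q)).
        as ! p + c = bs ! q)"

definition mat_image :: "'a::semiring_0 mat \<Rightarrow> 'a vec set" where
  "mat_image A = (\<lambda>v. A *\<^sub>v v) ` carrier_vec (dim_col A)"

text \<open>
  Multigraded free resolutions
  \<open>\<dots> \<rightarrow> F\<^sub>2 \<rightarrow> F\<^sub>1 \<rightarrow> F\<^sub>0 \<rightarrow> S/I \<rightarrow> 0\<close> by finitely generated free modules, where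
  \<open>F\<^sub>i = \<Oplus>\<^sub>p S(-ds i ! p)\<close> and \<open>D i : F\<^sub>i\<^sub>+\<^sub>1 \<rightarrow> F\<^sub>i\<close>. The augmentation
  \<open>F\<^sub>0 \<rightarrow> S/I\<close> is the composite of a multigraded map \<open>E : F\<^sub>0 \<rightarrow> S\<close> (a matrix with one row)
  and the projection to \<open>S/I\<close>. The last three conditions are surjectivity of the augmentation
  and exactness at \<open>F\<^sub>0\<close> and at \<open>F\<^sub>i\<^sub>+\<^sub>1\<close>.
\<close>

definition free_resolution ::
  "('n, 'k::field) mpoly set \<Rightarrow> (nat \<Rightarrow> 'n mon list) \<Rightarrow> (nat \<Rightarrow> ('n, 'k) mpoly mat) \<Rightarrow>
   ('n, 'k) mpoly mat \<Rightarrow> bool" where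
  "free_resolution I ds D E \<longleftrightarrow>
     graded_map [0] (ds 0) E \<and>
     (\<forall>i. graded_map (ds i) (ds (i + 1)) (D i)) \<and>
     (\<forall>f. \<exists>v \<in> carrier_vec (length (ds 0)). f - (E *\<^sub>v v) $ 0 \<in> I) \<and>
     {v \<in> carrier_vec (length (ds 0)). (E *\<^sub>v v) $ 0 \<in> I} = mat_image (D 0) \<and>
     (\<forall>i. mat_kernel (D i) = mat_image (D (i + 1)))"

text \<open>Minimality says that \<open>D i\<close> maps \<open>F\<^sub>i\<^sub>+\<^sub>1\<close> into \<open>\<mm> F\<^sub>i\<close> for the ideal \<open>\<mm>\<close> generated by
  the variables, i.e. that no entry of \<open>D i\<close> has a constant term.\<close>

definition minimal_free_resolution ::
  "('n, 'k::field) mpoly set \<Rightarrow> (nat \<Rightarrow> 'n mon list) \<Rightarrow> (nat \<Rightarrow> ('n, 'k) mpoly mat) \<Rightarrow>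
   ('n, 'k) mpoly mat \<Rightarrow> bool" where
  "minimal_free_resolution I ds D E \<longleftrightarrow>
     free_resolution I ds D E \<and>
     (\<forall>i. \<forall>p < length (ds i). \<forall>q < length (ds (i + 1)).
        Poly_Mapping.lookup (D i $$ (p, q)) 0 = 0)"

text \<open>The multigraded Betti number of \<open>S/I\<close> in homological degree \<open>i\<close> and multidegree \<open>m\<close>:
  the number of summands \<open>S(-m)\<close> in \<open>F\<^sub>i\<close>. Minimal free resolutions of \<open>S/I\<close> exist for
  monomial ideals and are unique up to isomorphism, so the choice is immaterial.\<close>

definition betti :: "('n, 'k::field) mpoly set \<Rightarrow> nat \<Rightarrow> 'n mon \<Rightarrow> nat" where
  "betti I i m =
     (SOME b. \<exists>ds D E. minimal_free_resolution I ds D E \<and> b = count_list (ds i) m)"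

end

theory Submission imports Defs begin

text \<open>
  Write \<open>t\<^sub>1, \<dots>, t\<^sub>s\<close> for the tail of the cover and \<open>m'\<close> for its least common multiple. A
  part of a minimal cover is a minimal cover of the ideal below it, since a smaller cover there could
  be exchanged into the given one (\<open>minimal_cover_sublist\<close>). The well ordering survives in the tail
  by irredundance: no element of a minimal cover divides the least common multiple of other
  elements (\<open>well_ordered_cover_drop\<close>).

  For the Betti number, every resolution \<open>F\<close> of \<open>S/I\<close> is shown to contain a summand \<open>S(-m')\<close> in
  homological degree \<open>s\<close>. Lifting the Taylor complex to \<open>F\<close> sends the basis element of
  \<open>{t\<^sub>1, \<dots>, t\<^sub>s}\<close> to an element \<open>w\<close> of multidegree \<open>m'\<close> (\<open>lifts_exist\<close>). On the other side, a
  linear functional on \<open>F\<^sub>s\<close> is built by recursion over the suffixes of the cover: on a basis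
  vector of multidegree \<open>b\<close> the functional of \<open>t\<^sub>k, \<dots>, t\<^sub>s\<close> is the functional of
  \<open>t\<^sub>k\<^sub>+\<^sub>1, \<dots>, t\<^sub>s\<close> applied to the boundary if \<open>t\<^sub>k\<close> divides \<open>lcm(b, t\<^sub>k\<^sub>+\<^sub>1, \<dots>, t\<^sub>s)\<close>, and
  \<open>0\<close> otherwise. The recursion forces that it only sees multidegrees divisible by
  \<open>t\<^sub>k, \<dots>, t\<^sub>s\<close> (\<open>detector_support\<close>). The well ordering says that every generator below \<open>m'\<close> satisfies
  the divisibility for some \<open>k\<close>, which makes the functional a cocycle in the multidegrees that
  matter (\<open>pairing_cocycle\<close>), and irredundance kills all faces of \<open>t\<^sub>k, \<dots>, t\<^sub>s\<close> but the one omitting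
  \<open>t\<^sub>k\<close>. By induction its value on \<open>w\<close> is \<open>1\<close> (\<open>pairing_lift\<close>). So \<open>w\<close> involves a basis
  vector whose multidegree is both a divisor and a multiple of \<open>m'\<close> (\<open>lcm_is_label\<close>).

  The Betti number is read off from some minimal multigraded resolution, so the existence of one
  is needed as well (\<open>minimal_free_resolution_exists\<close>). In a fixed multidegree a multigraded complex
  is a complex of finite-dimensional vector spaces given by scalar matrices, and exactness can be
  checked there (\<open>free_resolution_iff_strands\<close>). Since all degrees of generators can be kept
  square-free, only finitely many multidegrees matter, and a kernel has a finite set of graded
  generators. Taking one of least cardinality gives minimality.
\<close>

section \<open>Monomial ideals\<close>

abbreviation coef :: "('n, 'k::field) mpoly \<Rightarrow> 'n mon \<Rightarrow> 'k" where
  "coef \<equiv> Poly_Mapping.lookup"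

lemma mon_diff_add: "(a::'n mon) \<le> b \<Longrightarrow> a + (b - a) = b"
  by (auto simp: le_fun_def fun_eq_iff)

lemma mon_le_add: "(a::'n mon) \<le> a + b"
  by (auto simp: le_fun_def)

lemma mon_add_diff: "(a::'n mon) + b - a = b"
  by (auto simp: fun_eq_iff)

lemma coef_single_mult:
  "coef (Poly_Mapping.single c s * f) e = (if c \<le> e then s * coef f (e - c) else 0)"
proof -
  have inner: "(\<Sum>q. coef f q when e = k + q) = (if k \<le> e then coef f (e - k) else 0)" for k
  proof (cases "k \<le> e")
    case True
    have "(e = k + q) = (q = e - k)" for q
      using True by (auto simp: mon_diff_add mon_add_diff)
    then show ?thesis using True by simp
  next
    case False
    then have "e \<noteq> k + q" for q using mon_le_add by blast
    then show ?thesis using False by simp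
  qed
  have "coef (Poly_Mapping.single c s * f) e
      = (\<Sum>k. (s * (if k \<le> e then coef f (e - k) else 0)) when k = c)"
    unfolding lookup_mult inner
    by (rule arg_cong[where f = Sum_any]) (auto simp: fun_eq_iff lookup_single when_def)
  then show ?thesis by simp
qed

interpretation polymod: module "(*) :: ('n, 'k::field) mpoly \<Rightarrow> _ \<Rightarrow> _"
  by unfold_locales (auto simp: algebra_simps)

text \<open>
  A monomial ideal is spanned over the field by the monomials it contains. All later reasoning
  about the ideal only asks which monomials lie in it, and this is the bridge.
\<close>

lemma mem_ideal_of:
  fixes f :: "('n, 'k::field) mpoly"
  shows "f \<in> ideal_of A \<longleftrightarrow> (\<forall>c \<in> Poly_Mapping.keys f. \<exists>a\<in>A. a \<le> c)"
proof
  let ?M = "{f :: ('n, 'k) mpoly. \<forall>c. coef f c \<noteq> 0 \<longrightarrow> (\<exists>a\<in>A. a \<le> c)}"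
  have mult: "g * f \<in> ?M" if f: "f \<in> ?M" for g f
  proof (clarsimp)
    fix c assume "coef (g * f) c \<noteq> 0"
    then have "c \<in> Poly_Mapping.keys (g * f)" by (simp add: in_keys_iff)
    then obtain u v where "c = u + v" "v \<in> Poly_Mapping.keys f"
      using keys_mult[of g f] by blast
    moreover from this obtain a where "a \<in> A" "a \<le> v" using f by (auto simp: in_keys_iff)
    moreover have "v \<le> u + v" by (auto simp: le_fun_def)
    ultimately show "\<exists>a\<in>A. a \<le> c" using order_trans by blast
  qed
  have "polymod.subspace ?M"
    unfolding polymod.subspace_def
  proof (intro conjI ballI allI)
    fix f g assume "f \<in> ?M" "g \<in> ?M"
    moreover have "coef f c \<noteq> 0 \<or> coef g c \<noteq> 0" if "coef (f + g) c \<noteq> 0" for c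
      using that by (auto simp: lookup_add)
    ultimately show "f + g \<in> ?M" by blast
  qed (use mult in auto)
  moreover have "xpow ` A \<subseteq> ?M" by (auto simp: xpow_def lookup_single when_def split: if_splits)
  ultimately have "ideal_of A \<subseteq> ?M" unfolding ideal_of_def by (rule polymod.span_minimal[rotated])
  then show "f \<in> ideal_of A \<Longrightarrow> \<forall>c \<in> Poly_Mapping.keys f. \<exists>a\<in>A. a \<le> c"
    by (auto simp: in_keys_iff)
next
  assume *: "\<forall>c \<in> Poly_Mapping.keys f. \<exists>a\<in>A. a \<le> c"
  have "Poly_Mapping.single c (coef f c) \<in> ideal_of A" if "c \<in> Poly_Mapping.keys f" for c
  proof -
    obtain a where a: "a \<in> A" "a \<le> c" using * \<open>c \<in> _\<close> by blast
    have "Poly_Mapping.single c (coef f c) = Poly_Mapping.single (c - a) (coef f c) * xpow a"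
      using mon_diff_add[OF a(2)] by (simp add: xpow_def mult_single add.commute)
    then show ?thesis unfolding ideal_of_def
      using a polymod.span_scale polymod.span_base by (metis imageI)
  qed
  then have "(\<Sum>c\<in>Poly_Mapping.keys f. Poly_Mapping.single c (coef f c)) \<in> ideal_of A"
    unfolding ideal_of_def by (rule polymod.span_sum)
  moreover have "(\<Sum>c\<in>Poly_Mapping.keys f. Poly_Mapping.single c (coef f c)) = f"
    by (rule poly_mapping_eqI) (auto simp: lookup_sum lookup_single when_def in_keys_iff)
  ultimately show "f \<in> ideal_of A" by simp
qed

lemma xpow_in_ideal_of: "(xpow b :: ('n, 'k::field) mpoly) \<in> ideal_of A \<longleftrightarrow> (\<exists>a\<in>A. a \<le> b)"
  by (simp add: mem_ideal_of xpow_def)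

lemma minimal_mon_exists:
  fixes b :: "'n::finite mon"
  assumes "P b"
  obtains c where "c \<le> b" "P c" "\<And>d. P d \<Longrightarrow> d \<le> c \<Longrightarrow> d = c"
proof -
  obtain c where c: "P c \<and> c \<le> b" and min: "\<And>d. P d \<and> d \<le> b \<Longrightarrow> sum c UNIV \<le> sum d UNIV"
    using ex_has_least_nat[of "\<lambda>c. P c \<and> c \<le> b" b "\<lambda>c. sum c UNIV"] assms by auto
  have "d = c" if "P d" "d \<le> c" for d
  proof (rule ccontr)
    assume "d \<noteq> c"
    then obtain i where "d i < c i" using \<open>d \<le> c\<close> by (metis le_funD le_neq_implies_less ext)
    then have "sum d UNIV < sum c UNIV"
      using \<open>d \<le> c\<close> by (intro sum_strict_mono_ex1) (auto simp: le_fun_def)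
    moreover have "sum c UNIV \<le> sum d UNIV" using min[of d] that c by auto
    ultimately show False by simp
  qed
  with c show ?thesis using that by blast
qed

lemma xpow_in_iff_gens:
  fixes I :: "('n::finite, 'k::field) mpoly set"
  assumes "squarefree_monomial_ideal I"
  shows "xpow b \<in> I \<longleftrightarrow> (\<exists>g\<in>gens I. g \<le> b)"
proof
  assume "xpow b \<in> I"
  then obtain c where "c \<le> b" "xpow c \<in> I" "\<And>d. xpow d \<in> I \<Longrightarrow> d \<le> c \<Longrightarrow> d = c"
    using minimal_mon_exists[of "\<lambda>c. xpow c \<in> I"] by blast
  then show "\<exists>g\<in>gens I. g \<le> b" unfolding gens_def by blast
next
  assume "\<exists>g\<in>gens I. g \<le> b"
  moreover obtain A where "I = ideal_of A"
    using assms unfolding squarefree_monomial_ideal_def by blast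
  ultimately show "xpow b \<in> I"
    unfolding gens_def by (metis (mono_tags, lifting) mem_Collect_eq order_trans xpow_in_ideal_of)
qed

lemma gens_squarefree:
  fixes I :: "('n::finite, 'k::field) mpoly set"
  assumes "squarefree_monomial_ideal I" "g \<in> gens I"
  shows "g \<le> 1"
proof -
  obtain A where A: "\<forall>a\<in>A. \<forall>i. a i \<le> 1" "I = ideal_of A"
    using assms(1) unfolding squarefree_monomial_ideal_def by blast
  obtain a where "a \<in> A" "a \<le> g" using assms(2) A by (auto simp: gens_def xpow_in_ideal_of)
  moreover from this have "a = g" using assms(2) A(2) unfolding gens_def
    by (auto simp: xpow_in_ideal_of)
  ultimately show ?thesis using A by (auto simp: le_fun_def)
qed

text \<open>
  Membership in a square-free ideal only depends on the support of a monomial. This is why all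
  multidegrees in the resolution constructed below can be taken square-free, hence finite in number.
\<close>

lemma xpow_in_inf_one:
  fixes I :: "('n::finite, 'k::field) mpoly set"
  assumes "squarefree_monomial_ideal I"
  shows "xpow (inf b 1) \<in> I \<longleftrightarrow> xpow b \<in> I"
  using gens_squarefree[OF assms] by (auto simp: xpow_in_iff_gens[OF assms])

lemma mem_monomial_ideal:
  fixes I :: "('n, 'k::field) mpoly set"
  assumes "squarefree_monomial_ideal I"
  shows "f \<in> I \<longleftrightarrow> (\<forall>c. coef f c \<noteq> 0 \<longrightarrow> xpow c \<in> I)"
proof -
  obtain A where I: "I = ideal_of A"
    using assms unfolding squarefree_monomial_ideal_def by blast
  show ?thesis unfolding I xpow_in_ideal_of by (auto simp: mem_ideal_of in_keys_iff)
qed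

lemma gens_antichain: "g \<in> gens I \<Longrightarrow> h \<in> gens I \<Longrightarrow> g \<le> h \<Longrightarrow> g = h"
  unfolding gens_def by blast

lemma gens_ideal_below:
  "gens (ideal_below I m) = {g \<in> gens I. g \<le> m}"
  unfolding ideal_below_def gens_def[of "ideal_of _"] xpow_in_ideal_of
  by (auto dest: gens_antichain)

section \<open>Covers\<close>

lemma mon_lcm_le_iff: "mon_lcm as \<le> b \<longleftrightarrow> (\<forall>a \<in> set as. a \<le> b)"
  unfolding mon_lcm_def by (induction as) (auto simp: le_fun_def)

lemma mon_lcm_Nil [simp]: "mon_lcm [] = 0"
  and mon_lcm_Cons [simp]: "mon_lcm (a # as) = sup a (mon_lcm as)"
  by (simp_all add: mon_lcm_def)

lemma le_mon_lcm: "a \<in> set as \<Longrightarrow> a \<le> mon_lcm as"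
  using mon_lcm_le_iff by blast

lemma mon_lcm_mono: "set as \<subseteq> set bs \<Longrightarrow> mon_lcm as \<le> mon_lcm bs"
  by (auto simp: mon_lcm_le_iff le_mon_lcm)

lemma mon_lcm_pos: "0 < mon_lcm as i \<longleftrightarrow> (\<exists>a\<in>set as. 0 < a i)"
  by (induction as) (auto simp: sup_nat_def less_max_iff_disj)

text \<open>
  If a proper subset covered the smaller ideal, replacing the sublist by this subset inside the given
  minimal cover would give a smaller cover of the whole ideal.
\<close>

lemma minimal_cover_sublist:
  fixes I :: "('n, 'k::field) mpoly set"
  assumes "minimal_cover I (set ms)" and "set ns \<subseteq> set ms"
  shows "minimal_cover (ideal_below I (mon_lcm ns)) (set ns)"
proof -
  let ?J = "ideal_below I (mon_lcm ns)"
  have cov: "cover I (set ms)" and min: "\<And>C. C \<subset> set ms \<Longrightarrow> \<not> cover I C"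
    using assms by (auto simp: minimal_cover_def)
  have "cover ?J (set ns)"
    unfolding cover_def gens_ideal_below
  proof (intro conjI allI impI)
    show "set ns \<subseteq> {g \<in> gens I. g \<le> mon_lcm ns}"
      using cov assms(2) by (auto simp: cover_def le_mon_lcm)
    fix i assume "\<exists>g\<in>{g \<in> gens I. g \<le> mon_lcm ns}. 0 < g i"
    then have "0 < mon_lcm ns i" by (auto simp: le_fun_def intro: less_le_trans)
    then show "\<exists>c\<in>set ns. 0 < c i" by (simp add: mon_lcm_pos)
  qed
  moreover have "\<not> cover ?J C" if C: "C \<subset> set ns" for C
  proof
    assume covC: "cover ?J C"
    have "cover I (C \<union> (set ms - set ns))"
      unfolding cover_def
    proof (intro conjI allI impI)
      show "C \<union> (set ms - set ns) \<subseteq> gens I" using cov C assms(2) by (auto simp: cover_def)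
      fix i assume "\<exists>g\<in>gens I. 0 < g i"
      then obtain c where c: "c \<in> set ms" "0 < c i" using cov by (auto simp: cover_def)
      show "\<exists>c\<in>C \<union> (set ms - set ns). 0 < c i"
      proof (cases "c \<in> set ns")
        case True
        then have "c \<in> gens ?J" using cov c by (auto simp: gens_ideal_below cover_def le_mon_lcm)
        then show ?thesis using covC c by (auto simp: cover_def)
      qed (use c in auto)
    qed
    moreover have "C \<union> (set ms - set ns) \<subset> set ms" using C assms(2) by blast
    ultimately show False using min by blast
  qed
  ultimately show ?thesis by (auto simp: minimal_cover_def)
qed

text \<open>
  Every element of a minimal cover has a private variable; lists avoiding the element
  therefore have a least common multiple that misses this variable.
\<close>

lemma minimal_cover_irredundant:
  fixes I :: "('n::finite, 'k::field) mpoly set"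
  assumes "minimal_cover I C" "t \<in> C" "squarefree_monomial_ideal I" "set ns \<subseteq> C - {t}"
  shows "\<not> t \<le> mon_lcm ns"
proof
  assume le: "t \<le> mon_lcm ns"
  have cov: "cover I C" and min: "\<And>D. D \<subset> C \<Longrightarrow> \<not> cover I D"
    using assms by (auto simp: minimal_cover_def)
  have "cover I (C - {t})"
    unfolding cover_def
  proof (intro conjI allI impI)
    show "C - {t} \<subseteq> gens I" using cov by (auto simp: cover_def)
    fix i assume "\<exists>g\<in>gens I. 0 < g i"
    then obtain c where c: "c \<in> C" "0 < c i" using cov by (auto simp: cover_def)
    show "\<exists>c\<in>C - {t}. 0 < c i"
    proof (cases "c = t")
      case True
      then have "0 < mon_lcm ns i" using le c by (auto simp: le_fun_def intro: less_le_trans)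
      then show ?thesis using assms(4) by (auto simp: mon_lcm_pos)
    qed (use c in auto)
  qed
  then show False using min[of "C - {t}"] assms(2) by blast
qed

text \<open>
  In the tail ideal, the index \<open>j\<close> provided by the well ordering cannot lie in the removed initial
  part: there \<open>n\<close> divides the least common multiple of the tail, so \<open>ms ! j\<close> would divide the
  least common multiple of its successors, contradicting irredundance of the minimal cover.
\<close>

lemma well_ordered_cover_drop:
  fixes I :: "('n::finite, 'k::field) mpoly set"
  assumes I: "squarefree_monomial_ideal I" and woc: "well_ordered_cover I ms"
  shows "well_ordered_cover (ideal_below I (mon_lcm (drop a ms))) (drop a ms)"
proof -
  let ?ts = "drop a ms" and ?m = "mon_lcm (drop a ms)"
  have dist: "distinct ms" and min: "minimal_cover I (set ms)"
    and wo: "\<And>n. n \<in> gens I - set ms \<Longrightarrow>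
        \<exists>j. j + 1 < length ms \<and> ms ! j \<le> mon_lcm (n # drop (j + 1) ms)"
    using woc by (auto simp: well_ordered_cover_def)
  have "\<exists>j. j + 1 < length ?ts \<and> ?ts ! j \<le> mon_lcm (n # drop (j + 1) ?ts)"
    if n: "n \<in> gens I" "n \<le> ?m" "n \<notin> set ?ts" for n
  proof -
    have "n \<notin> set ms"
    proof
      assume "n \<in> set ms"
      moreover have "set ?ts \<subseteq> set ms - {n}" using n(3) set_drop_subset by fastforce
      ultimately show False using minimal_cover_irredundant[OF min _ I] n(2) by blast
    qed
    then obtain j where j: "j + 1 < length ms" "ms ! j \<le> mon_lcm (n # drop (j + 1) ms)"
      using wo n(1) by blast
    have "a \<le> j"
    proof (rule ccontr)
      assume "\<not> a \<le> j"
      then have "set ?ts \<subseteq> set (drop (j + 1) ms)" by (intro set_drop_subset_set_drop) simp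
      then have "n \<le> mon_lcm (drop (j + 1) ms)" using n(2) mon_lcm_mono order_trans by blast
      then have le: "ms ! j \<le> mon_lcm (drop (j + 1) ms)" using j(2) by (simp add: sup.absorb2)
      have "distinct (ms ! j # drop (j + 1) ms)"
        using dist j(1) by (metis Cons_nth_drop_Suc Suc_eq_plus1 add_lessD1 distinct_drop)
      then have "set (drop (j + 1) ms) \<subseteq> set ms - {ms ! j}" using set_drop_subset by fastforce
      then show False using minimal_cover_irredundant[OF min _ I] le j(1) by simp
    qed
    then show ?thesis using j by (intro exI[of _ "j - a"]) (auto simp: add.commute)
  qed
  then show ?thesis
    using dist minimal_cover_sublist[OF min set_drop_subset]
    unfolding well_ordered_cover_def gens_ideal_below by auto
qed

definition irredundant :: "'n mon list \<Rightarrow> bool" where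
  "irredundant ts \<longleftrightarrow> (\<forall>us y vs. ts = us @ y # vs \<longrightarrow> \<not> y \<le> mon_lcm (us @ vs))"

lemma irredundant_Cons:
  assumes "irredundant (t # ts)"
  shows "irredundant ts" "\<not> t \<le> mon_lcm ts"
    "ts = us @ y # vs \<Longrightarrow> \<not> y \<le> mon_lcm (t # us @ vs)"
proof -
  show "\<not> t \<le> mon_lcm ts" using assms unfolding irredundant_def by (metis append_Nil)
  show *: "\<not> y \<le> mon_lcm (t # us @ vs)" if "ts = us @ y # vs" for us y vs
    using assms that unfolding irredundant_def by (metis append_Cons)
  have "mon_lcm (us @ vs) \<le> mon_lcm (t # us @ vs)" for us vs :: "'a mon list"
    by (rule mon_lcm_mono) auto
  then show "irredundant ts" unfolding irredundant_def using * order_trans by blast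
qed

lemma minimal_cover_list_irredundant:
  fixes I :: "('n::finite, 'k::field) mpoly set"
  assumes "squarefree_monomial_ideal I" "minimal_cover I (set ts)" "distinct ts"
  shows "irredundant ts"
  unfolding irredundant_def
proof (intro allI impI)
  fix us y vs assume "ts = us @ y # vs"
  then show "\<not> y \<le> mon_lcm (us @ vs)"
    using assms(3) by (intro minimal_cover_irredundant[OF assms(2) _ assms(1)]) auto
qed

lemma ideal_below_squarefree:
  fixes I :: "('n::finite, 'k::field) mpoly set"
  assumes "squarefree_monomial_ideal I"
  shows "squarefree_monomial_ideal (ideal_below I m)"
  unfolding squarefree_monomial_ideal_def ideal_below_def
  using gens_squarefree[OF assms]
  by (intro exI[of _ "{g \<in> gens I. g \<le> m}"]) (auto simp: le_fun_def)

lemma proper_if_two_gens: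
  assumes "minimal_cover I (set ms)" "distinct ms" "2 \<le> length ms"
  shows "xpow 0 \<notin> I"
proof
  assume "xpow 0 \<in> I"
  then have "gens I \<subseteq> {0}" by (auto simp: gens_def)
  moreover have "set ms \<subseteq> gens I" using assms(1) by (simp add: minimal_cover_def cover_def)
  ultimately have "card (set ms) \<le> card {0 :: 'a mon}" by (intro card_mono) auto
  then show False using assms(2,3) by (simp add: distinct_card)
qed


section \<open>Multigraded maps in a fixed multidegree\<close>

text \<open>
  The part of the free module \<open>\<Oplus>\<^sub>p S(-as ! p)\<close> in multidegree \<open>b\<close> has as basis the multiples
  \<open>x\<^sup>b\<^sup>-\<^sup>a\<close> of the generators whose degree \<open>a\<close> divides \<open>b\<close>. Its elements are recorded by
  coefficient vectors; vectors are functions on \<open>nat\<close>, zero outside the index range, so that the strands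
  of different multidegrees sit inside one vector space.
\<close>

definition strand :: "'n mon list \<Rightarrow> 'n mon \<Rightarrow> (nat \<Rightarrow> 'k::field) set" where
  "strand as b = {x. \<forall>p. x p \<noteq> 0 \<longrightarrow> p < length as \<and> as ! p \<le> b}"

definition apply_cols :: "nat \<Rightarrow> (nat \<Rightarrow> nat \<Rightarrow> 'k::field) \<Rightarrow> (nat \<Rightarrow> 'k) \<Rightarrow> nat \<Rightarrow> 'k" where
  "apply_cols N d x p = (\<Sum>q<N. d p q * x q)"

text \<open>
  A multigraded map is determined by one scalar per matrix entry, and these scalars act in every
  multidegree alike. The condition is that of a homogeneous matrix: a nonzero scalar needs divisibility
  of the degrees.
\<close>

definition graded_scalars :: "'n mon list \<Rightarrow> 'n mon list \<Rightarrow> (nat \<Rightarrow> nat \<Rightarrow> 'k::field) \<Rightarrow> bool" where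
  "graded_scalars as bs d \<longleftrightarrow>
     (\<forall>p q. d p q \<noteq> 0 \<longrightarrow> p < length as \<and> q < length bs \<and> as ! p \<le> bs ! q)"

definition scalars ::
  "'n mon list \<Rightarrow> 'n mon list \<Rightarrow> ('n, 'k::field) mpoly mat \<Rightarrow> nat \<Rightarrow> nat \<Rightarrow> 'k" where
  "scalars as bs A p q =
     (if p < length as \<and> q < length bs \<and> as ! p \<le> bs ! q
      then coef (A $$ (p, q)) (bs ! q - as ! p) else 0)"

text \<open>
  Coefficient vector of the homogeneous component of \<open>v\<close> in multidegree \<open>b\<close>.
\<close>

definition hcomp :: "'n mon list \<Rightarrow> ('n, 'k::field) mpoly vec \<Rightarrow> 'n mon \<Rightarrow> nat \<Rightarrow> 'k" where
  "hcomp as v b p = (if p < length as \<and> as ! p \<le> b then coef (v $ p) (b - as ! p) else 0)"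

text \<open>
  The passage back from a coefficient vector to a homogeneous vector of multidegree \<open>b\<close>.
\<close>

definition hvec :: "'n mon list \<Rightarrow> 'n mon \<Rightarrow> (nat \<Rightarrow> 'k::field) \<Rightarrow> ('n, 'k) mpoly vec" where
  "hvec as b x = vec (length as) (\<lambda>p. Poly_Mapping.single (b - as ! p) (x p))"

definition graded_mat ::
  "'n mon list \<Rightarrow> 'n mon list \<Rightarrow> (nat \<Rightarrow> nat \<Rightarrow> 'k::field) \<Rightarrow> ('n, 'k) mpoly mat" where
  "graded_mat as bs d = mat (length as) (length bs)
     (\<lambda>(p, q). Poly_Mapping.single (bs ! q - as ! p) (d p q))"

lemma strandD: "x \<in> strand as b \<Longrightarrow> x p \<noteq> 0 \<Longrightarrow> p < length as \<and> as ! p \<le> b"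
  by (simp add: strand_def)

lemma strand_mono: "b \<le> c \<Longrightarrow> strand as b \<subseteq> strand as c"
  unfolding strand_def using order_trans by blast

lemma zero_in_strand [simp]: "(\<lambda>_. 0) \<in> strand as b"
  by (simp add: strand_def)

lemma strand_inf_one:
  assumes "\<And>a. a \<in> set as \<Longrightarrow> a \<le> 1"
  shows "strand as (inf b 1) = strand as b"
  using assms by (auto simp: strand_def)

lemma hcomp_in_strand [simp]: "hcomp as v b \<in> strand as b"
  by (simp add: hcomp_def strand_def)

lemma scalars_graded [simp]: "graded_scalars as bs (scalars as bs A)"
  by (simp add: graded_scalars_def scalars_def)

lemma apply_cols_zero [simp]: "apply_cols N d (\<lambda>_. 0) = (\<lambda>_. 0)"
  by (simp add: apply_cols_def fun_eq_iff)

lemma hcomp_inject: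
  assumes "v \<in> carrier_vec (length as)" "w \<in> carrier_vec (length as)"
    and eq: "\<And>b. hcomp as v b = hcomp as w b"
  shows "v = w"
proof (rule eq_vecI)
  fix p assume "p < dim_vec w"
  then have p: "p < length as" using assms by auto
  show "v $ p = w $ p"
  proof (rule poly_mapping_eqI)
    fix c
    have "as ! p \<le> as ! p + c" by (rule mon_le_add)
    then show "coef (v $ p) c = coef (w $ p) c"
      using fun_cong[OF eq[of "as ! p + c"], of p] p by (simp add: hcomp_def mon_add_diff)
  qed
qed (use assms in auto)

lemma hvec_carrier [simp]: "hvec as b x \<in> carrier_vec (length as)"
  by (simp add: hvec_def)

lemma hcomp_hvec:
  assumes "x \<in> strand as b"
  shows "hcomp as (hvec as b x) c = (if c = b then x else (\<lambda>_. 0))"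
proof
  fix p
  show "hcomp as (hvec as b x) c p = (if c = b then x else (\<lambda>_. 0)) p"
  proof (cases "p < length as \<and> as ! p \<le> c \<and> x p \<noteq> 0")
    case True
    then have "as ! p \<le> b" using strandD[OF assms] by blast
    then have "b - as ! p = c - as ! p \<longleftrightarrow> c = b"
      using mon_diff_add[of "as ! p" b] mon_diff_add[of "as ! p" c] True by (metis (no_types))
    then show ?thesis using True by (simp add: hcomp_def hvec_def lookup_single when_def)
  next
    case False
    then consider "x p = 0" | "\<not> (p < length as \<and> as ! p \<le> c)" "x p \<noteq> 0" by blast
    then show ?thesis
    proof cases
      case 1
      then show ?thesis by (simp add: hcomp_def hvec_def)
    next
      case 2
      then have "c \<noteq> b" using strandD[OF assms] by blast
      then show ?thesis using 2(1) by (auto simp: hcomp_def)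
    qed
  qed
qed

lemma graded_map_entry:
  assumes "graded_map as bs A" "p < length as" "q < length bs"
  shows "A $$ (p, q) = Poly_Mapping.single (bs ! q - as ! p) (scalars as bs A p q)"
proof (rule poly_mapping_eqI)
  fix c
  have deg: "as ! p + c = bs ! q" if "coef (A $$ (p, q)) c \<noteq> 0"
    using assms that by (auto simp: graded_map_def in_keys_iff)
  have "as ! p \<le> bs ! q \<and> bs ! q - as ! p = c" if "coef (A $$ (p, q)) c \<noteq> 0"
    using deg[OF that, symmetric] by (simp add: mon_add_diff mon_le_add)
  then show "coef (A $$ (p, q)) c
      = coef (Poly_Mapping.single (bs ! q - as ! p) (scalars as bs A p q)) c"
    using assms(2,3)
    by (auto simp: lookup_single when_def scalars_def)
qed

lemma hcomp_mult_mat_vec: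
  assumes A: "graded_map as bs A" and v: "v \<in> carrier_vec (length bs)"
  shows "hcomp as (A *\<^sub>v v) b = apply_cols (length bs) (scalars as bs A) (hcomp bs v b)"
proof
  fix p
  have dim: "A \<in> carrier_mat (length as) (length bs)" using A by (simp add: graded_map_def)
  show "hcomp as (A *\<^sub>v v) b p = apply_cols (length bs) (scalars as bs A) (hcomp bs v b) p"
  proof (cases "p < length as \<and> as ! p \<le> b")
    case True
    have entry: "coef (A $$ (p, q) * v $ q) (b - as ! p) = scalars as bs A p q * hcomp bs v b q"
      if q: "q < length bs" for q
    proof (cases "as ! p \<le> bs ! q")
      case le: True
      have "bs ! q - as ! p \<le> b - as ! p \<longleftrightarrow> bs ! q \<le> b"
        using True le by (auto simp: le_fun_def le_diff_iff)
      moreover have "b - as ! p - (bs ! q - as ! p) = b - bs ! q"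
        using True le by (auto simp: fun_eq_iff le_fun_def)
      ultimately show ?thesis using q True
        by (simp add: graded_map_entry[OF A] coef_single_mult hcomp_def)
    qed (use q True in \<open>simp add: graded_map_entry[OF A] scalars_def\<close>)
    have "(A *\<^sub>v v) $ p = (\<Sum>q<length bs. A $$ (p, q) * v $ q)"
      using dim v True by (simp add: scalar_prod_def atLeast0LessThan)
    then show ?thesis
      using True by (simp add: hcomp_def[of as] lookup_sum entry apply_cols_def)
  next
    case False
    have "scalars as bs A p q * hcomp bs v b q = 0" for q
    proof (rule ccontr)
      assume "\<not> ?thesis"
      then have "p < length as" "as ! p \<le> bs ! q" "bs ! q \<le> b"
        by (auto simp: scalars_def hcomp_def split: if_splits)
      then show False using False order_trans by blast
    qed
    then show ?thesis using False
      by (simp only: hcomp_def[of as] apply_cols_def if_False sum.neutral_const)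
  qed
qed

lemma graded_mat_graded:
  assumes "graded_scalars as bs d"
  shows "graded_map as bs (graded_mat as bs d)"
  using assms unfolding graded_map_def graded_mat_def graded_scalars_def
  by (auto simp: in_keys_iff lookup_single when_def mon_diff_add split: if_splits)

lemma scalars_graded_mat:
  assumes "graded_scalars as bs d"
  shows "scalars as bs (graded_mat as bs d) = d"
  using assms unfolding scalars_def graded_mat_def graded_scalars_def
  by (auto simp: fun_eq_iff)

lemma finite_hcomp_support:
  "finite {b. hcomp as v b \<noteq> (\<lambda>_. 0)}"
proof (rule finite_subset)
  show "{b. hcomp as v b \<noteq> (\<lambda>_. 0)} \<subseteq> (\<Union>p<length as. (+) (as ! p) ` Poly_Mapping.keys (v $ p))"
  proof
    fix b assume "b \<in> {b. hcomp as v b \<noteq> (\<lambda>_. 0)}"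
    then obtain p where "hcomp as v b p \<noteq> 0" by (auto simp: fun_eq_iff)
    then have "p < length as" "as ! p \<le> b" "coef (v $ p) (b - as ! p) \<noteq> 0"
      by (auto simp: hcomp_def split: if_splits)
    then show "b \<in> (\<Union>p<length as. (+) (as ! p) ` Poly_Mapping.keys (v $ p))"
      by (intro UN_I[of p] image_eqI[of _ _ "b - as ! p"]) (auto simp: in_keys_iff mon_diff_add)
  qed
qed simp

lemma vec_of_hcomps:
  fixes y :: "'n mon \<Rightarrow> nat \<Rightarrow> 'k::field"
  assumes fin: "finite {b. y b \<noteq> (\<lambda>_. 0)}" and y: "\<And>b. y b \<in> strand bs b"
  obtains u where "u \<in> carrier_vec (length bs)" "\<And>b. hcomp bs u b = y b"
proof -
  define u where "u = vec (length bs) (\<lambda>q. Abs_poly_mapping (\<lambda>c. y (bs ! q + c) q))"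
  have "finite {c. y (bs ! q + c) q \<noteq> 0}" for q
  proof (rule finite_subset)
    show "{c. y (bs ! q + c) q \<noteq> 0} \<subseteq> (\<lambda>b. b - bs ! q) ` {b. y b \<noteq> (\<lambda>_. 0)}"
    proof
      fix c assume "c \<in> {c. y (bs ! q + c) q \<noteq> 0}"
      then have "y (bs ! q + c) \<noteq> (\<lambda>_. 0)" by auto
      then show "c \<in> (\<lambda>b. b - bs ! q) ` {b. y b \<noteq> (\<lambda>_. 0)}"
        by (intro image_eqI[of _ _ "bs ! q + c"]) (auto simp: mon_add_diff)
    qed
  qed (use fin in simp)
  then have "hcomp bs u b q = y b q" for b q
    using strandD[OF y[of b], of q] by (auto simp: hcomp_def u_def mon_diff_add)
  then have "hcomp bs u b = y b" for b by auto
  moreover have "u \<in> carrier_vec (length bs)" by (simp add: u_def)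
  ultimately show ?thesis using that by blast
qed

text \<open>
  Exactness can be tested one multidegree at a time, where it is a statement about vector spaces.
  For the passage back to polynomial vectors, preimages are chosen in each multidegree and added up;
  choosing \<open>0\<close> as preimage of \<open>0\<close> keeps this sum finite.
\<close>

lemma mat_image_iff_strands:
  assumes A: "graded_map as bs A" and K: "\<And>b. K b \<subseteq> strand as b" "\<And>b. (\<lambda>_. 0) \<in> K b"
  shows "{v \<in> carrier_vec (length as). \<forall>b. hcomp as v b \<in> K b} = mat_image A \<longleftrightarrow>
    (\<forall>b. K b = apply_cols (length bs) (scalars as bs A) ` strand bs b)"
    (is "?M = _ \<longleftrightarrow> (\<forall>b. K b = ?d ` _)")
proof -
  have dim: "A \<in> carrier_mat (length as) (length bs)" using A by (simp add: graded_map_def)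
  have image: "mat_image A = (*\<^sub>v) A ` carrier_vec (length bs)"
    using dim by (auto simp: mat_image_def)
  show ?thesis
  proof
    assume M: "?M = mat_image A"
    show "\<forall>b. K b = ?d ` strand bs b"
    proof (intro allI equalityI subsetI)
      fix b x assume x: "x \<in> K b"
      then have xs: "x \<in> strand as b" using K by blast
      have "hvec as b x \<in> ?M" using x K(2) by (simp add: hcomp_hvec[OF xs])
      then obtain u where u: "u \<in> carrier_vec (length bs)" "hvec as b x = A *\<^sub>v u"
        using M image by auto
      have "x = hcomp as (A *\<^sub>v u) b" using u(2) hcomp_hvec[OF xs, of b] by simp
      also have "\<dots> = ?d (hcomp bs u b)" by (rule hcomp_mult_mat_vec[OF A u(1)])
      finally show "x \<in> ?d ` strand bs b" by auto
    next
      fix b x assume "x \<in> ?d ` strand bs b"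
      then obtain y where y: "y \<in> strand bs b" "x = ?d y" by blast
      have "A *\<^sub>v hvec bs b y \<in> ?M" using M image by auto
      then have "hcomp as (A *\<^sub>v hvec bs b y) b \<in> K b" by blast
      then show "x \<in> K b" using y by (simp add: hcomp_mult_mat_vec[OF A] hcomp_hvec)
    qed
  next
    assume *: "\<forall>b. K b = ?d ` strand bs b"
    show "?M = mat_image A"
    proof (intro equalityI subsetI)
      fix v assume v: "v \<in> ?M"
      have "\<exists>y \<in> strand bs b. hcomp as v b = ?d y \<and> (hcomp as v b = (\<lambda>_. 0) \<longrightarrow> y = (\<lambda>_. 0))" for b
      proof (cases "hcomp as v b = (\<lambda>_. 0)")
        case True
        then show ?thesis by (intro bexI[of _ "\<lambda>_. 0"]) auto
      next
        case False
        have "hcomp as v b \<in> ?d ` strand bs b" using v * by blast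
        then show ?thesis using False by blast
      qed
      then obtain y where y: "\<And>b. y b \<in> strand bs b" "\<And>b. hcomp as v b = ?d (y b)"
        "\<And>b. hcomp as v b = (\<lambda>_. 0) \<Longrightarrow> y b = (\<lambda>_. 0)" by metis
      have "finite {b. y b \<noteq> (\<lambda>_. 0)}"
        by (rule finite_subset[OF _ finite_hcomp_support[of as v]]) (use y(3) in auto)
      then obtain u where u: "u \<in> carrier_vec (length bs)" "\<And>b. hcomp bs u b = y b"
        using vec_of_hcomps y(1) by metis
      have "v = A *\<^sub>v u"
        by (rule hcomp_inject[of _ as])
           (use v dim u y in \<open>auto simp: hcomp_mult_mat_vec[OF A u(1)]\<close>)
      then show "v \<in> mat_image A" using u(1) image by blast
    next
      fix v assume "v \<in> mat_image A"
      then obtain u where u: "u \<in> carrier_vec (length bs)" "v = A *\<^sub>v u" using image by blast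
      then show "v \<in> ?M" using * dim by (auto simp: hcomp_mult_mat_vec[OF A u(1)])
    qed
  qed
qed

lemma mat_kernel_strands:
  fixes A :: "('n, 'k::field) mpoly mat"
  assumes A: "graded_map as bs A"
  shows "mat_kernel A = {v \<in> carrier_vec (length bs). \<forall>b.
     hcomp bs v b \<in> {x \<in> strand bs b. apply_cols (length bs) (scalars as bs A) x = (\<lambda>_. 0)}}"
proof -
  have dim: "A \<in> carrier_mat (length as) (length bs)" using A by (simp add: graded_map_def)
  have "A *\<^sub>v v = 0\<^sub>v (length as) \<longleftrightarrow> (\<forall>b. hcomp as (A *\<^sub>v v) b = (\<lambda>_. 0))"
    if v: "v \<in> carrier_vec (length bs)" for v
  proof -
    have z: "hcomp as (0\<^sub>v (length as) :: ('n, 'k) mpoly vec) b = (\<lambda>_. 0)" for b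
      by (auto simp: hcomp_def)
    then show ?thesis using hcomp_inject[of "A *\<^sub>v v" as "0\<^sub>v (length as)"] dim v by auto
  qed
  then show ?thesis
    unfolding mat_kernel[OF dim] by (auto simp: hcomp_mult_mat_vec[OF A])
qed

section \<open>Minimal generators of graded families of subspaces\<close>

interpretation coeffs: vector_space "\<lambda>(c::'k::field) (x::nat \<Rightarrow> 'k) p. c * x p"
  by unfold_locales (auto simp: fun_eq_iff algebra_simps)

lemma sum_fun_apply: "(\<Sum>w\<in>A. f w) p = (\<Sum>w\<in>A. f w p :: 'a::comm_monoid_add)"
  by (induction A rule: infinite_finite_induct) auto

lemma finite_generating_set:
  fixes K :: "(nat \<Rightarrow> 'k::field) set"
  assumes "\<And>x p. x \<in> K \<Longrightarrow> x p \<noteq> 0 \<Longrightarrow> p < N"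
  obtains B where "finite B" "B \<subseteq> K" "\<And>x. x \<in> K \<Longrightarrow> \<exists>u. x = (\<lambda>p. \<Sum>w\<in>B. u w * w p)"
proof -
  let ?e = "\<lambda>p q. if q = p then 1 else (0::'k)"
  obtain B where B: "B \<subseteq> K" "coeffs.independent B" "K \<subseteq> coeffs.span B"
    by (rule coeffs.maximal_independent_subset)
  have "K \<subseteq> coeffs.span (?e ` {..<N})"
  proof
    fix x assume x: "x \<in> K"
    have "x = (\<Sum>p<N. (\<lambda>q. x p * ?e p q))"
    proof
      fix q
      have "(\<Sum>p<N. x p * ?e p q) = (\<Sum>p<N. if p = q then x p else 0)"
        by (rule sum.cong) auto
      also have "\<dots> = x q" using assms[OF x, of q] by auto
      finally show "x q = (\<Sum>p<N. (\<lambda>q. x p * ?e p q)) q" by (simp add: sum_fun_apply)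
    qed
    moreover have "\<dots> \<in> coeffs.span (?e ` {..<N})"
      by (intro coeffs.span_sum coeffs.span_scale coeffs.span_base) auto
    ultimately show "x \<in> coeffs.span (?e ` {..<N})" by simp
  qed
  then have fin: "finite B"
    using coeffs.independent_span_bound[of "?e ` {..<N}" B] B by auto
  have "\<exists>u. x = (\<lambda>p. \<Sum>w\<in>B. u w * w p)" if "x \<in> K" for x
  proof -
    have "x \<in> range (\<lambda>u. \<Sum>w\<in>B. (\<lambda>p. u w * w p))"
      using that B(3) unfolding coeffs.span_finite[OF fin] by blast
    then obtain u where u: "x = (\<Sum>w\<in>B. (\<lambda>p. u w * w p))" by blast
    have "x = (\<lambda>p. \<Sum>w\<in>B. u w * w p)"
      by (rule ext) (simp add: u sum_fun_apply)
    then show ?thesis by (rule exI[of _ u])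
  qed
  then show ?thesis using that fin B(1) by blast
qed

lemma finite_squarefree_mons: "finite {b :: 'n::finite mon. b \<le> 1}"
proof (rule finite_subset)
  show "{b :: 'n mon. b \<le> 1} \<subseteq> range (\<lambda>S i. if i \<in> S then 1 else 0)"
  proof
    fix b :: "'n mon" assume "b \<in> {b. b \<le> 1}"
    then have "b i \<le> 1" for i by (simp add: le_fun_def)
    then have "b = (\<lambda>i. if i \<in> {i. b i = 1} then 1 else 0)"
      by (auto simp: fun_eq_iff le_Suc_eq)
    then show "b \<in> range (\<lambda>S i. if i \<in> S then 1 else 0)" by blast
  qed
qed simp

text \<open>
  A family \<open>K\<close> of subspaces indexed by multidegrees is a graded submodule of a free module in the strand
  encoding. A generator consists of a multidegree and a vector; in multidegree \<open>b\<close> it may be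
  used if its own degree divides \<open>b\<close>.
\<close>

definition generates ::
  "('n mon \<times> (nat \<Rightarrow> 'k::field)) set \<Rightarrow> ('n mon \<Rightarrow> (nat \<Rightarrow> 'k) set) \<Rightarrow> bool" where
  "generates W K \<longleftrightarrow> finite W \<and> (\<forall>w\<in>W. fst w \<le> 1 \<and> snd w \<in> K (fst w)) \<and>
     (\<forall>b. \<forall>x \<in> K b. \<exists>c. (\<forall>w\<in>W. c w \<noteq> 0 \<longrightarrow> fst w \<le> b) \<and> x = (\<lambda>p. \<Sum>w\<in>W. c w * snd w p))"

text \<open>
  The component in multidegree \<open>b\<close> agrees with the one in the square-free multidegree \<open>inf b 1\<close>,
  so bases of the finitely many square-free components already generate.
\<close>

lemma generates_exists:
  fixes K :: "'n::finite mon \<Rightarrow> (nat \<Rightarrow> 'k::field) set"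
  assumes K: "\<And>b. K b \<subseteq> strand as b" and inf: "\<And>b. K (inf b 1) = K b"
  obtains W where "generates W K"
proof -
  have "\<forall>b. \<exists>B. finite B \<and> B \<subseteq> K b \<and> (\<forall>x\<in>K b. \<exists>u. x = (\<lambda>p. \<Sum>w\<in>B. u w * w p))"
  proof
    fix b
    have "p < length as" if "x \<in> K b" "x p \<noteq> 0" for x p
      using strandD[of x as b p] K[of b] that by blast
    then show "\<exists>B. finite B \<and> B \<subseteq> K b \<and> (\<forall>x\<in>K b. \<exists>u. x = (\<lambda>p. \<Sum>w\<in>B. u w * w p))"
      by (rule finite_generating_set[of "K b" "length as"]) blast+
  qed
  from choice[OF this] obtain B where "\<forall>b. finite (B b) \<and> B b \<subseteq> K b \<and>
      (\<forall>x\<in>K b. \<exists>u. x = (\<lambda>p. \<Sum>w\<in>B b. u w * w p))" ..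
  then have B: "\<And>b. finite (B b)" "\<And>b. B b \<subseteq> K b"
    "\<And>b x. x \<in> K b \<Longrightarrow> \<exists>u. x = (\<lambda>p. \<Sum>w\<in>B b. u w * w p)" by blast+
  let ?Q = "{b :: 'n mon. b \<le> 1}"
  have "\<exists>c. (\<forall>w\<in>Sigma ?Q B. c w \<noteq> 0 \<longrightarrow> fst w \<le> b) \<and>
      x = (\<lambda>p. \<Sum>w\<in>Sigma ?Q B. c w * snd w p)" if x: "x \<in> K b" for b x
  proof -
    let ?b = "inf b 1"
    have "x \<in> K ?b" using x inf[of b] by simp
    then obtain u where u: "x = (\<lambda>p. \<Sum>w\<in>B ?b. u w * w p)" using B(3) by blast
    define c where "c = (\<lambda>w. if fst w = ?b then u (snd w) else (0::'k))"
    have "(\<Sum>w\<in>Sigma ?Q B. c w * snd w p) = x p" for p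
    proof -
      have "(\<Sum>l\<in>?Q. \<Sum>w\<in>B l. c (l, w) * w p) = (\<Sum>(l, w)\<in>Sigma ?Q B. c (l, w) * w p)"
        by (rule sum.Sigma[OF finite_squarefree_mons]) (use B(1) in blast)
      then have "(\<Sum>w\<in>Sigma ?Q B. c w * snd w p) = (\<Sum>l\<in>?Q. \<Sum>w\<in>B l. c (l, w) * w p)"
        by (simp only: case_prod_unfold prod.collapse)
      also have "\<dots> = (\<Sum>l\<in>?Q. if l = ?b then \<Sum>w\<in>B l. u w * w p else 0)"
        by (rule sum.cong) (auto simp: c_def)
      also have "\<dots> = (\<Sum>w\<in>B ?b. u w * w p)"
        by (subst sum.delta[OF finite_squarefree_mons]) simp
      also have "\<dots> = x p" using u by simp
      finally show ?thesis .
    qed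
    then have "x = (\<lambda>p. \<Sum>w\<in>Sigma ?Q B. c w * snd w p)" by auto
    then show ?thesis by (intro exI[of _ c]) (auto simp: c_def)
  qed
  moreover have "finite (Sigma ?Q B)" using finite_squarefree_mons B(1) by blast
  moreover have "\<forall>w\<in>Sigma ?Q B. fst w \<le> 1 \<and> snd w \<in> K (fst w)" using B(2) by auto
  ultimately have "generates (Sigma ?Q B) K" unfolding generates_def by blast
  then show ?thesis using that by blast
qed

text \<open>
  A graded form of Nakayama's lemma: in a relation of degree \<open>b\<close>, a generator of degree \<open>b\<close> with nonzero
  coefficient could be expressed by the others and discarded, so it cannot occur when the number
  of generators is minimal.
\<close>

lemma minimal_generates_independent:
  assumes W: "generates W K" and min: "\<And>V. generates V K \<Longrightarrow> card W \<le> card V"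
    and c: "\<And>w. w \<in> W \<Longrightarrow> c w \<noteq> 0 \<Longrightarrow> fst w \<le> b"
    and rel: "\<And>p. (\<Sum>w\<in>W. c w * snd w p) = 0"
    and w0: "w0 \<in> W" "fst w0 = b"
  shows "c w0 = 0"
proof (rule ccontr)
  assume c0: "c w0 \<noteq> 0"
  have fin: "finite W" using W by (simp add: generates_def)
  have "\<exists>c'. (\<forall>w\<in>W - {w0}. c' w \<noteq> 0 \<longrightarrow> fst w \<le> b') \<and> x = (\<lambda>p. \<Sum>w\<in>W - {w0}. c' w * snd w p)"
    if "x \<in> K b'" for b' x
  proof -
    obtain y where y: "\<forall>w\<in>W. y w \<noteq> 0 \<longrightarrow> fst w \<le> b'" "x = (\<lambda>p. \<Sum>w\<in>W. y w * snd w p)"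
      using W \<open>x \<in> K b'\<close> unfolding generates_def by blast
    \<comment> \<open>Eliminate \<open>w0\<close> from the expression \<open>y\<close> by means of the relation \<open>c\<close>.\<close>
    define c' where "c' = (\<lambda>w. y w - y w0 / c w0 * c w)"
    have "fst w \<le> b'" if "w \<in> W" "c' w \<noteq> 0" for w
    proof (cases "y w = 0")
      case True
      then have "y w0 \<noteq> 0" "c w \<noteq> 0" using that by (auto simp: c'_def)
      then show ?thesis using y(1) c[OF \<open>w \<in> W\<close>] w0 order_trans by blast
    qed (use y that in auto)
    moreover have "x p = (\<Sum>w\<in>W - {w0}. c' w * snd w p)" for p
    proof -
      have "(\<Sum>w\<in>W - {w0}. c' w * snd w p) = (\<Sum>w\<in>W. c' w * snd w p)"
        using fin w0 c0 by (subst sum.remove[of W w0]) (auto simp: c'_def)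
      also have "\<dots> = (\<Sum>w\<in>W. y w * snd w p) - y w0 / c w0 * (\<Sum>w\<in>W. c w * snd w p)"
        unfolding c'_def left_diff_distrib sum_subtractf sum_distrib_left by (simp add: mult.assoc)
      finally show ?thesis using y(2) rel by simp
    qed
    ultimately show ?thesis by (intro exI[of _ c']) auto
  qed
  then have "generates (W - {w0}) K"
    using W unfolding generates_def by auto
  then have "card W \<le> card (W - {w0})" by (rule min)
  then show False using fin w0 by (meson card_Diff1_less not_le)
qed

text \<open>
  The generators become the columns of a scalar matrix \<open>d\<close>. The last conclusion says that a
  syzygy has no unit coefficient, which makes the next map of the resolution minimal.
\<close>

lemma minimal_graded_generators:
  fixes K :: "'n::finite mon \<Rightarrow> (nat \<Rightarrow> 'k::field) set"
  assumes K: "\<And>b. K b \<subseteq> strand as b" and inf: "\<And>b. K (inf b 1) = K b"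
    and mono: "\<And>b c. b \<le> c \<Longrightarrow> K b \<subseteq> K c"
    and zero: "\<And>b. (\<lambda>_. 0) \<in> K b"
    and closed: "\<And>b c x y. x \<in> K b \<Longrightarrow> y \<in> K b \<Longrightarrow> (\<lambda>p. x p + y p * c) \<in> K b"
  obtains bs d where "graded_scalars as bs d" "\<And>l. l \<in> set bs \<Longrightarrow> l \<le> 1"
    "\<And>b. K b = apply_cols (length bs) d ` strand bs b"
    "\<And>b x q. x \<in> strand bs b \<Longrightarrow> apply_cols (length bs) d x = (\<lambda>_. 0) \<Longrightarrow>
       q < length bs \<Longrightarrow> bs ! q = b \<Longrightarrow> x q = 0"
proof -
  obtain W0 where "generates W0 K" using generates_exists[of K as] K inf by blast
  then obtain W where W: "generates W K" and min: "\<And>V. generates V K \<Longrightarrow> card W \<le> card V"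
    using ex_has_least_nat[of "\<lambda>W. generates W K" W0 card] by blast
  have fin: "finite W" and mem: "\<And>w. w \<in> W \<Longrightarrow> fst w \<le> 1 \<and> snd w \<in> K (fst w)"
    and gen: "\<And>b x. x \<in> K b \<Longrightarrow>
      \<exists>c. (\<forall>w\<in>W. c w \<noteq> 0 \<longrightarrow> fst w \<le> b) \<and> x = (\<lambda>p. \<Sum>w\<in>W. c w * snd w p)"
    using W by (auto simp: generates_def)
  obtain ws where ws: "set ws = W" "distinct ws" using finite_distinct_list[OF fin] by blast
  let ?n = "length ws"
  have bij: "bij_betw ((!) ws) {..<?n} W" using ws by (intro bij_betw_nth) auto
  define bs where "bs = map fst ws"
  define d where "d = (\<lambda>p q. if q < ?n then snd (ws ! q) p else 0)"
  have len: "length bs = ?n" by (simp add: bs_def)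
  have nth: "ws ! q \<in> W" "bs ! q = fst (ws ! q)" if "q < ?n" for q
    using that ws by (auto simp: bs_def)
  have comb: "apply_cols (length bs) d x p = (\<Sum>w\<in>W. c w * snd w p)"
    if "\<And>q. q < ?n \<Longrightarrow> c (ws ! q) = x q" for c x p
  proof -
    have "(\<Sum>w\<in>W. c w * snd w p) = (\<Sum>q<?n. c (ws ! q) * snd (ws ! q) p)"
      by (rule sum.reindex_bij_betw[OF bij, symmetric])
    then show ?thesis using that by (simp add: apply_cols_def d_def len mult.commute)
  qed
  have "graded_scalars as bs d"
    unfolding graded_scalars_def
  proof (intro allI impI)
    fix p q assume "d p q \<noteq> 0"
    then have q: "q < ?n" "snd (ws ! q) p \<noteq> 0" by (auto simp: d_def split: if_splits)
    have "snd (ws ! q) \<in> strand as (bs ! q)" using mem[OF nth(1)[OF q(1)]] nth(2)[OF q(1)] K by auto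
    from strandD[OF this q(2)] show "p < length as \<and> q < length bs \<and> as ! p \<le> bs ! q"
      using q len by simp
  qed
  moreover have "l \<le> 1" if "l \<in> set bs" for l using that mem ws by (auto simp: bs_def)
  moreover have "K b = apply_cols (length bs) d ` strand bs b" for b
  proof (intro equalityI subsetI)
    fix x assume "x \<in> K b"
    then obtain c where c: "\<forall>w\<in>W. c w \<noteq> 0 \<longrightarrow> fst w \<le> b" "x = (\<lambda>p. \<Sum>w\<in>W. c w * snd w p)"
      using gen by blast
    define y where "y = (\<lambda>q. if q < ?n then c (ws ! q) else 0)"
    have "apply_cols (length bs) d y p = (\<Sum>w\<in>W. c w * snd w p)" for p
      by (rule comb) (simp add: y_def)
    then have "x = apply_cols (length bs) d y" using c(2) by auto
    moreover have "y \<in> strand bs b"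
      using c(1) nth by (auto simp: strand_def y_def len split: if_splits)
    ultimately show "x \<in> apply_cols (length bs) d ` strand bs b" by blast
  next
    fix x assume "x \<in> apply_cols (length bs) d ` strand bs b"
    then obtain y where y: "y \<in> strand bs b" "x = apply_cols (length bs) d y" by blast
    have "(\<lambda>p. \<Sum>q\<in>S. d p q * y q) \<in> K b" if "finite S" for S
      using that
    proof (induction S)
      case (insert q S)
      have "(\<lambda>p. (\<Sum>q\<in>S. d p q * y q) + d p q * y q) \<in> K b"
      proof (cases "y q = 0")
        case False
        then have q: "q < ?n" "bs ! q \<le> b" using strandD[OF y(1)] len by auto
        then have "fst (ws ! q) \<le> b" using nth(2) by simp
        then have "snd (ws ! q) \<in> K b" using mem[OF nth(1)[OF q(1)]] mono by blast
        then have "(\<lambda>p. d p q) \<in> K b" using q(1) by (simp add: d_def)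
        then show ?thesis by (rule closed[OF insert.IH])
      qed (use insert.IH in simp)
      then show ?case using insert.hyps by (simp add: add.commute)
    qed (simp add: zero)
    from this[of "{..<length bs}"] have "(\<lambda>p. apply_cols (length bs) d y p) \<in> K b"
      unfolding apply_cols_def by simp
    then show "x \<in> K b" using y by simp
  qed
  moreover have "x q = 0" if x: "x \<in> strand bs b" "apply_cols (length bs) d x = (\<lambda>_. 0)"
    and q: "q < length bs" "bs ! q = b" for b x q
  proof -
    define c where "c = (\<lambda>w. x (inv_into {..<?n} ((!) ws) w))"
    have cq: "c (ws ! q) = x q" if "q < ?n" for q
      using that bij by (simp add: c_def bij_betw_def)
    have "c (ws ! q) = 0"
    proof (rule minimal_generates_independent[OF W min])
      fix w assume "w \<in> W" "c w \<noteq> 0"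
      moreover from this obtain r where "r < ?n" "w = ws ! r" using ws(1) by (metis in_set_conv_nth)
      ultimately show "fst w \<le> b" using strandD[OF x(1), of r] cq nth by auto
    next
      fix p
      have "apply_cols (length bs) d x p = (\<Sum>w\<in>W. c w * snd w p)" by (rule comb) (rule cq)
      then show "(\<Sum>w\<in>W. c w * snd w p) = 0" using x(2) by simp
    qed (use q nth len in auto)
    then show ?thesis using cq q len by simp
  qed
  ultimately show ?thesis by (rule that)
qed

section \<open>Existence of minimal free resolutions\<close>

lemma zero_le_mon [simp]: "(0 :: 'n mon) \<le> b"
  by (simp add: le_fun_def)

text \<open>
  In multidegree \<open>b\<close> the quotient \<open>S/I\<close> is \<open>0\<close> or the field, according to whether \<open>x\<^sup>b\<close> lies in \<open>I\<close>.
  This is the disjunction in the condition at \<open>F\<^sub>0\<close>.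
\<close>

lemma free_resolution_iff_strands:
  fixes I :: "('n, 'k::field) mpoly set"
  assumes I: "squarefree_monomial_ideal I"
    and E: "graded_map [0] (ds 0) E"
    and D: "\<And>i. graded_map (ds i) (ds (i + 1)) (D i)"
  shows "free_resolution I ds D E \<longleftrightarrow>
    (\<forall>f. \<exists>v \<in> carrier_vec (length (ds 0)). f - (E *\<^sub>v v) $ 0 \<in> I) \<and>
    (\<forall>b. {x \<in> strand (ds 0) b. xpow b \<in> I \<or>
            apply_cols (length (ds 0)) (scalars [0] (ds 0) E) x 0 = 0} =
         apply_cols (length (ds 1)) (scalars (ds 0) (ds 1) (D 0)) ` strand (ds 1) b) \<and>
    (\<forall>i b. {x \<in> strand (ds (i + 1)) b.
            apply_cols (length (ds (i + 1))) (scalars (ds i) (ds (i + 1)) (D i)) x = (\<lambda>_. 0)} =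
         apply_cols (length (ds (i + 2))) (scalars (ds (i + 1)) (ds (i + 2)) (D (i + 1)))
           ` strand (ds (i + 2)) b)"
proof -
  let ?K = "\<lambda>b. {x \<in> strand (ds 0) b. xpow b \<in> I \<or>
            apply_cols (length (ds 0)) (scalars [0] (ds 0) E) x 0 = 0}"
  have dimE: "E \<in> carrier_mat 1 (length (ds 0))" using E by (simp add: graded_map_def)
  have "(E *\<^sub>v v) $ 0 \<in> I \<longleftrightarrow> (\<forall>b. hcomp (ds 0) v b \<in> ?K b)"
    if v: "v \<in> carrier_vec (length (ds 0))" for v
  proof -
    have "coef ((E *\<^sub>v v) $ 0) b
        = apply_cols (length (ds 0)) (scalars [0] (ds 0) E) (hcomp (ds 0) v b) 0" for b
      using fun_cong[OF hcomp_mult_mat_vec[OF E v, of b], of 0]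
      by (simp add: hcomp_def[of "[0]"])
    then show ?thesis using mem_monomial_ideal[OF I, of "(E *\<^sub>v v) $ 0"] by auto
  qed
  then have "{v \<in> carrier_vec (length (ds 0)). (E *\<^sub>v v) $ 0 \<in> I} =
      {v \<in> carrier_vec (length (ds 0)). \<forall>b. hcomp (ds 0) v b \<in> ?K b}" by blast
  moreover have "{v \<in> carrier_vec (length (ds 0)). \<forall>b. hcomp (ds 0) v b \<in> ?K b} = mat_image (D 0) \<longleftrightarrow>
      (\<forall>b. ?K b = apply_cols (length (ds 1)) (scalars (ds 0) (ds 1) (D 0)) ` strand (ds 1) b)"
    using D[of 0] by (intro mat_image_iff_strands) auto
  moreover have "mat_kernel (D i) = mat_image (D (i + 1)) \<longleftrightarrow>
      (\<forall>b. {x \<in> strand (ds (i + 1)) b.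
            apply_cols (length (ds (i + 1))) (scalars (ds i) (ds (i + 1)) (D i)) x = (\<lambda>_. 0)} =
         apply_cols (length (ds (i + 2))) (scalars (ds (i + 1)) (ds (i + 2)) (D (i + 1)))
           ` strand (ds (i + 2)) b)" for i
    unfolding mat_kernel_strands[OF D]
    using D[of "i + 1"] by (intro mat_image_iff_strands) auto
  ultimately show ?thesis
    using E D unfolding free_resolution_def by simp
qed

lemma apply_cols_add_scale:
  "apply_cols N d (\<lambda>p. x p + y p * c) p = apply_cols N d x p + apply_cols N d y p * c"
  by (simp add: apply_cols_def algebra_simps sum.distrib sum_distrib_left)

lemma strand_add_scale:
  "x \<in> strand as b \<Longrightarrow> y \<in> strand as b \<Longrightarrow> (\<lambda>p. x p + y p * c) \<in> strand as b"
  by (force simp: strand_def)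

text \<open>
  The invariant of the inductive construction: the map given by \<open>d\<close> is minimal, and so is
  every map onto its kernel.
\<close>

definition minimal_step ::
  "'n mon list \<times> 'n mon list \<times> (nat \<Rightarrow> nat \<Rightarrow> 'k::field) \<Rightarrow> bool" where
  "minimal_step = (\<lambda>(as, bs, d). graded_scalars as bs d \<and> (\<forall>l\<in>set bs. l \<le> 1) \<and>
     (\<forall>p. \<forall>q<length bs. as ! p = bs ! q \<longrightarrow> d p q = 0) \<and>
     (\<forall>x q. x \<in> strand bs (bs ! q) \<longrightarrow> apply_cols (length bs) d x = (\<lambda>_. 0) \<longrightarrow>
        q < length bs \<longrightarrow> x q = 0))"

text \<open>
  The hypothesis \<open>top\<close> is minimality of the preceding map: elements of \<open>K\<close> have no unit coefficients.
  It turns into minimality of \<open>d\<close>, whose columns are elements of \<open>K\<close>.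
\<close>

lemma minimal_step_exists:
  fixes K :: "'n::finite mon \<Rightarrow> (nat \<Rightarrow> 'k::field) set"
  assumes K: "\<And>b. K b \<subseteq> strand as b" and inf: "\<And>b. K (inf b 1) = K b"
    and mono: "\<And>b c. b \<le> c \<Longrightarrow> K b \<subseteq> K c"
    and zero: "\<And>b. (\<lambda>_. 0) \<in> K b"
    and closed: "\<And>b c x y. x \<in> K b \<Longrightarrow> y \<in> K b \<Longrightarrow> (\<lambda>p. x p + y p * c) \<in> K b"
    and top: "\<And>p x. x \<in> K (as ! p) \<Longrightarrow> p < length as \<Longrightarrow> x p = 0"
  obtains bs d where "minimal_step (as, bs, d)"
    "\<And>b. K b = apply_cols (length bs) d ` strand bs b"
proof (rule minimal_graded_generators[of K as, OF K inf mono zero closed])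
  fix bs d
  assume *: "graded_scalars as bs d" "\<And>l. l \<in> set bs \<Longrightarrow> l \<le> 1"
    "\<And>b. K b = apply_cols (length bs) d ` strand bs b"
    "\<And>b x q. x \<in> strand bs b \<Longrightarrow> apply_cols (length bs) d x = (\<lambda>_. 0) \<Longrightarrow>
       q < length bs \<Longrightarrow> bs ! q = b \<Longrightarrow> x q = 0"
  have "d p q = 0" if q: "q < length bs" "as ! p = bs ! q" for p q
  proof (rule ccontr)
    assume nz: "d p q \<noteq> 0"
    then have p: "p < length as" using *(1) by (auto simp: graded_scalars_def)
    let ?e = "\<lambda>r. if r = q then 1 else (0::'k)"
    have "?e \<in> strand bs (bs ! q)" using q(1) by (simp add: strand_def)
    then have "apply_cols (length bs) d ?e \<in> K (as ! p)" using *(3) q(2) by auto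
    then have "apply_cols (length bs) d ?e p = 0" using top p by blast
    moreover have "apply_cols (length bs) d ?e p = (\<Sum>r<length bs. if r = q then d p r else 0)"
      unfolding apply_cols_def by (rule sum.cong) auto
    ultimately show False using nz q(1) by simp
  qed
  then have "minimal_step (as, bs, d)"
    using * unfolding minimal_step_def by blast
  then show ?thesis using *(3) by (rule that)
qed

text \<open>
  Start from \<open>F\<^sub>0 = S\<close> and cover the ideal, then repeatedly the kernel just obtained, by a minimal
  set of square-free generators. Properness of the ideal is what makes the first map minimal.
\<close>

lemma minimal_free_resolution_exists:
  fixes I :: "('n::finite, 'k::field) mpoly set"
  assumes I: "squarefree_monomial_ideal I" and proper: "xpow 0 \<notin> I"
  shows "\<exists>ds D E. minimal_free_resolution I ds D E"
proof -
  define K0 where "K0 = (\<lambda>b. {x :: nat \<Rightarrow> 'k. x \<in> strand [0] b \<and> (xpow b \<in> I \<or> x 0 = 0)})"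
  have up: "xpow c \<in> I" if "xpow b \<in> I" "b \<le> c" for b c
    using that by (auto simp: xpow_in_iff_gens[OF I] intro: order_trans)
  obtain bs0 d0 where base: "minimal_step ([0], bs0, d0)"
    "\<And>b. K0 b = apply_cols (length bs0) d0 ` strand bs0 b"
  proof (rule minimal_step_exists[of K0 "[0]"])
    fix b :: "'n mon"
    have "strand [0] (inf b 1) = (strand [0] b :: (nat \<Rightarrow> 'k) set)"
      by (rule strand_inf_one) simp
    then show "K0 (inf b 1) = K0 b" unfolding K0_def xpow_in_inf_one[OF I] by simp
  next
    fix b c :: "'n mon" assume "b \<le> c"
    then show "K0 b \<subseteq> K0 c" unfolding K0_def using strand_mono up by blast
  next
    fix p and x :: "nat \<Rightarrow> 'k" assume "x \<in> K0 ([0] ! p)" "p < length [0 :: 'n mon]"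
    then show "x p = 0" using proper by (simp add: K0_def)
  qed (auto simp: K0_def intro: strand_add_scale)
  define ker where "ker = (\<lambda>(bs :: 'n mon list) (d :: nat \<Rightarrow> nat \<Rightarrow> 'k) b.
     {x \<in> strand bs b. apply_cols (length bs) d x = (\<lambda>_. 0)})"
  define link where "link = (\<lambda>(s :: 'n mon list \<times> 'n mon list \<times> (nat \<Rightarrow> nat \<Rightarrow> 'k))
      (t :: 'n mon list \<times> 'n mon list \<times> (nat \<Rightarrow> nat \<Rightarrow> 'k)). fst t = fst (snd s) \<and>
     (\<forall>b. ker (fst (snd s)) (snd (snd s)) b
        = apply_cols (length (fst (snd t))) (snd (snd t)) ` strand (fst (snd t)) b))"
  have step: "\<exists>t. minimal_step t \<and> link s t"
    if s: "minimal_step s" for s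
  proof -
    obtain as bs d where s_eq: "s = (as, bs, d)" by (cases s)
    have labels: "l \<le> 1" if "l \<in> set bs" for l
      using s that by (auto simp: minimal_step_def s_eq)
    obtain cs e where "minimal_step (bs, cs, e)"
      "\<And>b. ker bs d b = apply_cols (length cs) e ` strand cs b"
    proof (rule minimal_step_exists[of "ker bs d" bs])
      fix b :: "'n mon"
      have "strand bs (inf b 1) = (strand bs b :: (nat \<Rightarrow> 'k) set)"
        by (rule strand_inf_one) (rule labels)
      then show "ker bs d (inf b 1) = ker bs d b" unfolding ker_def by simp
    next
      fix b c :: "'n mon" assume "b \<le> c"
      then show "ker bs d b \<subseteq> ker bs d c" unfolding ker_def using strand_mono by blast
    next
      fix p x assume "x \<in> ker bs d (bs ! p)" "p < length bs"
      then show "x p = 0" using s by (auto simp: ker_def minimal_step_def s_eq)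
    next
      fix b c x y assume "x \<in> ker bs d b" "y \<in> ker bs d b"
      then show "(\<lambda>p. x p + y p * c) \<in> ker bs d b"
        by (auto simp: ker_def strand_add_scale apply_cols_add_scale)
    qed (auto simp: ker_def)
    then show ?thesis by (intro exI[of _ "(bs, cs, e)"]) (auto simp: s_eq link_def)
  qed
  have "\<exists>f. \<forall>i. (minimal_step (f i) \<and> (i = 0 \<longrightarrow> f i = ([0], bs0, d0))) \<and> link (f i) (f (Suc i))"
  proof (rule dependent_nat_choice, goal_cases)
    case 1
    show ?case using base(1) by blast
  next
    case (2 s i)
    then obtain t where "minimal_step t \<and> link s t" using step by blast
    then show ?case by (intro exI[of _ t]) simp
  qed
  then obtain f where f: "\<And>i. minimal_step (f i)" "f 0 = ([0], bs0, d0)"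
    and link: "\<And>i. link (f i) (f (Suc i))" by blast
  define ds where "ds = (\<lambda>i. fst (f i))"
  define d where "d = (\<lambda>i. snd (snd (f i)))"
  have f_eq: "f i = (ds i, ds (Suc i), d i)" for i
    using link[of i] by (simp add: ds_def d_def link_def)
  have ms: "minimal_step (ds i, ds (Suc i), d i)" for i using f(1)[of i] f_eq by simp
  then have gr: "graded_scalars (ds i) (ds (Suc i)) (d i)" for i by (simp add: minimal_step_def)
  have ds0: "ds 0 = [0]" "ds (Suc 0) = bs0" "d 0 = d0" using f(2) f_eq[of 0] by auto
  define D where "D = (\<lambda>i. graded_mat (ds i) (ds (Suc i)) (d i))"
  define e :: "nat \<Rightarrow> nat \<Rightarrow> 'k" where "e = (\<lambda>p q. if p = 0 \<and> q = 0 then 1 else 0)"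
  define E where "E = graded_mat [0 :: 'n mon] [0] e"
  have gre: "graded_scalars [0 :: 'n mon] [0] e" by (auto simp: graded_scalars_def e_def split: if_splits)
  have scD: "scalars (ds i) (ds (Suc i)) (D i) = d i" for i
    unfolding D_def by (rule scalars_graded_mat[OF gr])
  have scE: "scalars [0] (ds 0) E = e"
    unfolding E_def ds0 by (rule scalars_graded_mat[OF gre])
  have E1: "(E *\<^sub>v v) $ 0 = v $ 0" if "v \<in> carrier_vec 1" for v
    using that by (simp add: E_def graded_mat_def e_def scalar_prod_def single_one)
  have "free_resolution I ds D E"
  proof (subst free_resolution_iff_strands[OF I])
    show "graded_map [0] (ds 0) E" using graded_mat_graded[OF gre] by (simp add: E_def ds0)
    show "graded_map (ds i) (ds (i + 1)) (D i)" for i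
      using graded_mat_graded[OF gr[of i]] by (simp add: D_def)
    have "0 \<in> I" using mem_monomial_ideal[OF I, of 0] by simp
    then have "\<exists>v \<in> carrier_vec (length (ds 0)). f - (E *\<^sub>v v) $ 0 \<in> I" for f
      by (intro bexI[of _ "vec 1 (\<lambda>_. f)"]) (simp_all add: E1 ds0)
    moreover have "{x \<in> strand (ds 0) b. xpow b \<in> I \<or>
            apply_cols (length (ds 0)) (scalars [0] (ds 0) E) x 0 = 0} =
         apply_cols (length (ds 1)) (scalars (ds 0) (ds 1) (D 0)) ` strand (ds 1) b" for b
      using base(2)[of b] scD[of 0] unfolding scE
      by (simp add: ds0 K0_def e_def apply_cols_def[of "Suc 0"])
    moreover have "{x \<in> strand (ds (i + 1)) b.
            apply_cols (length (ds (i + 1))) (scalars (ds i) (ds (i + 1)) (D i)) x = (\<lambda>_. 0)} =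
         apply_cols (length (ds (i + 2))) (scalars (ds (i + 1)) (ds (i + 2)) (D (i + 1)))
           ` strand (ds (i + 2)) b" for i b
      using link[of i] scD[of i] scD[of "Suc i"] by (simp add: f_eq ker_def link_def)
    ultimately show "(\<forall>f. \<exists>v \<in> carrier_vec (length (ds 0)). f - (E *\<^sub>v v) $ 0 \<in> I) \<and>
      (\<forall>b. {x \<in> strand (ds 0) b. xpow b \<in> I \<or>
            apply_cols (length (ds 0)) (scalars [0] (ds 0) E) x 0 = 0} =
         apply_cols (length (ds 1)) (scalars (ds 0) (ds 1) (D 0)) ` strand (ds 1) b) \<and>
      (\<forall>i b. {x \<in> strand (ds (i + 1)) b.
            apply_cols (length (ds (i + 1))) (scalars (ds i) (ds (i + 1)) (D i)) x = (\<lambda>_. 0)} =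
         apply_cols (length (ds (i + 2))) (scalars (ds (i + 1)) (ds (i + 2)) (D (i + 1)))
           ` strand (ds (i + 2)) b)" by blast
  qed
  moreover have "coef (D i $$ (p, q)) 0 = 0" if pq: "p < length (ds i)" "q < length (ds (i + 1))" for i p q
  proof (cases "ds i ! p \<le> ds (Suc i) ! q \<and> ds (Suc i) ! q - ds i ! p = 0")
    case True
    then have "ds i ! p = ds (Suc i) ! q" by (metis add.right_neutral mon_diff_add)
    then have "d i p q = 0" using ms[of i] pq by (simp add: minimal_step_def)
    then show ?thesis using pq by (simp add: D_def graded_mat_def)
  next
    case False
    then have "d i p q = 0 \<or> ds (Suc i) ! q - ds i ! p \<noteq> 0"
      using gr[of i] unfolding graded_scalars_def by blast
    then show ?thesis using pq by (auto simp: D_def graded_mat_def lookup_single when_def)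
  qed
  ultimately show ?thesis unfolding minimal_free_resolution_def by blast
qed

section \<open>Alternating sums over faces\<close>

text \<open>
  The alternating sum of the values of \<open>f\<close> on the lists obtained by removing one entry: the boundary
  of the augmented simplex on ordered lists. In recursive form, \<open>\<partial>\<partial> = 0\<close> needs no bookkeeping
  with signs.
\<close>

primrec alt_sum :: "('a list \<Rightarrow> 'b::ab_group_add) \<Rightarrow> 'a list \<Rightarrow> 'b" where
  "alt_sum f [] = 0"
| "alt_sum f (x # xs) = f xs - alt_sum (\<lambda>ys. f (x # ys)) xs"

lemma alt_sum_diff: "alt_sum (\<lambda>ys. f ys - g ys) xs = alt_sum f xs - alt_sum g xs"
  by (induction xs arbitrary: f g) auto

lemma alt_sum_alt_sum: "alt_sum (alt_sum f) xs = 0"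
  by (induction xs arbitrary: f) (auto simp: alt_sum_diff)

lemma alt_sum_additive:
  assumes "h 0 = 0" "\<And>x y. h (x - y) = h x - h y"
  shows "h (alt_sum f xs) = alt_sum (\<lambda>ys. h (f ys)) xs"
  by (induction xs arbitrary: f) (auto simp: assms)

lemma alt_sum_cong:
  assumes "\<And>us y vs. xs = us @ y # vs \<Longrightarrow> f (us @ vs) = g (us @ vs)"
  shows "alt_sum f xs = alt_sum g xs"
  using assms
proof (induction xs arbitrary: f g)
  case (Cons x xs)
  have "f xs = g xs" using Cons.prems[of "[]"] by simp
  moreover have "alt_sum (\<lambda>ys. f (x # ys)) xs = alt_sum (\<lambda>ys. g (x # ys)) xs"
  proof (rule Cons.IH)
    fix us y vs assume "xs = us @ y # vs"
    then show "f (x # us @ vs) = g (x # us @ vs)" using Cons.prems[of "x # us"] by simp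
  qed
  ultimately show ?case by simp
qed simp

lemma alt_sum_mem:
  assumes "0 \<in> S" "\<And>x y. x \<in> S \<Longrightarrow> y \<in> S \<Longrightarrow> x - y \<in> S"
    and "\<And>us y vs. xs = us @ y # vs \<Longrightarrow> f (us @ vs) \<in> S"
  shows "alt_sum f xs \<in> S"
  using assms(3)
proof (induction xs arbitrary: f)
  case (Cons x xs)
  have "f xs \<in> S" using Cons.prems[of "[]"] by simp
  moreover have "alt_sum (\<lambda>ys. f (x # ys)) xs \<in> S"
  proof (rule Cons.IH)
    fix us y vs assume "xs = us @ y # vs"
    then show "f (x # us @ vs) \<in> S" using Cons.prems[of "x # us"] by simp
  qed
  ultimately show ?case using assms(2) by simp
qed (simp add: assms(1))

lemma alt_sum_zero:
  assumes "\<And>us y vs. xs = us @ y # vs \<Longrightarrow> f (us @ vs) = 0"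
  shows "alt_sum f xs = 0"
  using alt_sum_mem[of "{0}" xs f] assms by auto

section \<open>Well ordered covers force a multidegree in every resolution\<close>

text \<open>
  The condition on generators in a well ordered cover, with an arbitrary monomial \<open>b\<close> in place of the
  generator. It passes to multiples, so a well ordered cover satisfies it for all monomials of
  the ideal.
\<close>

primrec hits :: "'n mon list \<Rightarrow> 'n mon \<Rightarrow> bool" where
  "hits [] b = False"
| "hits (t # ts) b = (t \<le> sup b (mon_lcm ts) \<or> hits ts b)"

lemma hits_append: "t \<le> sup b (mon_lcm vs) \<Longrightarrow> hits (us @ t # vs) b"
  by (induction us) auto

lemma hits_mono: "hits ts b \<Longrightarrow> b \<le> c \<Longrightarrow> hits ts c"
proof (induction ts)
  case (Cons t ts)
  have "sup b (mon_lcm ts) \<le> sup c (mon_lcm ts)" using Cons.prems(2) by (rule sup_mono) simp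
  then have "t \<le> sup c (mon_lcm ts)" if "t \<le> sup b (mon_lcm ts)"
    using that order_trans by blast
  then show ?case using Cons by auto
qed simp

text \<open>
  A multigraded resolution of \<open>S/I\<close> in the strand encoding; \<open>e\<close> holds the coefficients of the map
  \<open>F\<^sub>0 \<rightarrow> S\<close>.
\<close>

locale strand_resolution =
  fixes I :: "('n, 'k::field) mpoly set"
    and ds :: "nat \<Rightarrow> 'n mon list"
    and d :: "nat \<Rightarrow> nat \<Rightarrow> nat \<Rightarrow> 'k"
    and e :: "nat \<Rightarrow> 'k"
  assumes up: "\<And>b c. xpow b \<in> I \<Longrightarrow> b \<le> c \<Longrightarrow> xpow c \<in> I"
    and graded: "\<And>i. graded_scalars (ds i) (ds (Suc i)) (d i)"
    and exact0: "\<And>b. {x \<in> strand (ds 0) b. xpow b \<in> I \<or> (\<Sum>p<length (ds 0). e p * x p) = 0} =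
         apply_cols (length (ds (Suc 0))) (d 0) ` strand (ds (Suc 0)) b"
    and exact: "\<And>i b. {x \<in> strand (ds (Suc i)) b. apply_cols (length (ds (Suc i))) (d i) x = (\<lambda>_. 0)} =
         apply_cols (length (ds (Suc (Suc i)))) (d (Suc i)) ` strand (ds (Suc (Suc i))) b"
    and unit: "\<exists>w \<in> strand (ds 0) 0. (\<Sum>p<length (ds 0). e p * w p) = 1"
begin

abbreviation boundary :: "nat \<Rightarrow> (nat \<Rightarrow> 'k) \<Rightarrow> nat \<Rightarrow> 'k" where
  "boundary i \<equiv> apply_cols (length (ds (Suc i))) (d i)"

text \<open>
  The linear functional on \<open>F\<^sub>i\<close>, \<open>i = length ts\<close>, that detects the image of \<open>ts\<close>. It is modelled on
  the coefficient of \<open>ts\<close> in a comparison map from the resolution to the full simplex on the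
  entries of the cover. Such a map comes from a contraction of the simplex in each multidegree \<open>b\<close>;
  when the contraction adjoins the first entry at which \<open>b\<close> is hit, the coefficients of the suffixes
  of the cover determine each other in the multidegrees of interest, and no other coefficients have
  to be computed.
\<close>

primrec detector :: "'n mon list \<Rightarrow> nat \<Rightarrow> 'k" where
  "detector [] = e"
| "detector (t # ts) = (\<lambda>q. if t \<le> sup (ds (Suc (length ts)) ! q) (mon_lcm ts)
     then \<Sum>p<length (ds (length ts)). detector ts p * d (length ts) p q else 0)"

definition pairing :: "'n mon list \<Rightarrow> (nat \<Rightarrow> 'k) \<Rightarrow> 'k" where
  "pairing ts x = (\<Sum>p<length (ds (length ts)). detector ts p * x p)"

text \<open>
  For a suffix of a well ordered cover and \<open>b\<close> the least common multiple of the suffix, this holds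
  because an earlier entry at which a divisor of \<open>b\<close> is hit would be redundant in the cover.
\<close>

definition hit_below :: "'n mon list \<Rightarrow> 'n mon \<Rightarrow> bool" where
  "hit_below ts b \<longleftrightarrow> (\<forall>c\<le>b. xpow c \<in> I \<longrightarrow> hits ts c)"

lemma hit_below_mono: "hit_below ts b \<Longrightarrow> c \<le> b \<Longrightarrow> hit_below ts c"
  unfolding hit_below_def using order_trans by blast

lemma hit_below_Cons:
  assumes "hit_below (t # ts) b" "\<not> t \<le> sup b (mon_lcm ts)"
  shows "hit_below ts b"
  unfolding hit_below_def
proof (intro allI impI)
  fix c assume c: "c \<le> b" "xpow c \<in> I"
  have "sup c (mon_lcm ts) \<le> sup b (mon_lcm ts)" using c(1) by (rule sup_mono) simp
  then have "\<not> t \<le> sup c (mon_lcm ts)" using assms(2) order_trans by blast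
  moreover have "hits (t # ts) c" using assms(1) c unfolding hit_below_def by blast
  ultimately show "hits ts c" by simp
qed

lemma pairing_boundary:
  "pairing ts (boundary (length ts) x) =
     (\<Sum>q<length (ds (Suc (length ts))). (\<Sum>p<length (ds (length ts)). detector ts p * d (length ts) p q) * x q)"
  unfolding pairing_def apply_cols_def sum_distrib_left sum_distrib_right
  by (subst sum.swap) (simp add: mult.assoc)

text \<open>
  If \<open>t\<close> is not hit at the label of a basis vector, then \<open>ts\<close> alone is hit below this label, and the
  cocycle property \<open>coc\<close> makes the right-hand side vanish there, as the definition of \<open>detector\<close> does on the
  left. So in this range the functional of \<open>t # ts\<close> is that of \<open>ts\<close> composed with the differential.
\<close>

lemma pairing_Cons:
  assumes coc: "\<And>b x. hit_below ts b \<Longrightarrow> x \<in> strand (ds (Suc (length ts))) b \<Longrightarrow>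
      pairing ts (boundary (length ts) x) = 0"
    and hit: "hit_below (t # ts) b" and x: "x \<in> strand (ds (Suc (length ts))) b"
  shows "pairing (t # ts) x = pairing ts (boundary (length ts) x)"
proof -
  let ?n = "length ts" and ?L = "\<lambda>q. ds (Suc (length ts)) ! q"
  have "detector (t # ts) q * x q = (\<Sum>p<length (ds ?n). detector ts p * d ?n p q) * x q"
    if q: "q < length (ds (Suc ?n))" for q
  proof (cases "x q = 0 \<or> t \<le> sup (?L q) (mon_lcm ts)")
    case False
    then have "?L q \<le> b" using strandD[OF x] by blast
    then have "hit_below ts (?L q)" using hit False hit_below_Cons hit_below_mono by blast
    \<comment> \<open>Basis vector with index \<open>q\<close>, of multidegree \<open>?L q\<close>.\<close>
    let ?u = "\<lambda>r. if r = q then 1 else (0::'k)"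
    have "pairing ts (boundary ?n ?u) = 0"
      by (rule coc[OF \<open>hit_below ts (?L q)\<close>]) (use q in \<open>simp add: strand_def\<close>)
    moreover have "pairing ts (boundary ?n ?u) = (\<Sum>r<length (ds (Suc ?n)). if r = q
        then \<Sum>p<length (ds ?n). detector ts p * d ?n p r else 0)"
      unfolding pairing_boundary by (rule sum.cong) auto
    ultimately show ?thesis using q False by simp
  qed auto
  then show ?thesis unfolding pairing_boundary pairing_def[of "t # ts"] length_Cons
    by (intro sum.cong refl) (simp only: lessThan_iff)
qed

text \<open>
  For nonempty lists this is \<open>\<partial>\<partial> = 0\<close> after \<open>pairing_Cons\<close>. For the empty list, no monomial
  of the ideal lies below \<open>b\<close>, so boundaries map to \<open>0\<close> in \<open>S\<close>.
\<close>

lemma pairing_cocycle: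
  assumes "hit_below ts b" "x \<in> strand (ds (Suc (length ts))) b"
  shows "pairing ts (boundary (length ts) x) = 0"
  using assms
proof (induction ts arbitrary: b x)
  case Nil
  have "xpow b \<notin> I" using Nil(1) by (auto simp: hit_below_def)
  then show ?case using exact0[of b] Nil(2) by (auto simp: pairing_def)
next
  case (Cons t ts)
  let ?y = "boundary (Suc (length ts)) x"
  have y: "?y \<in> {x \<in> strand (ds (Suc (length ts))) b. boundary (length ts) x = (\<lambda>_. 0)}"
    using Cons.prems(2) unfolding exact by auto
  have "pairing (t # ts) ?y = pairing ts (boundary (length ts) ?y)"
    by (rule pairing_Cons[OF Cons.IH Cons.prems(1)]) (use y in auto)
  then show ?case using y by (simp add: pairing_def)
qed

text \<open>
  By recursion, \<open>ts\<close> divides the label of a basis vector on which the functional of \<open>t # ts\<close> does not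
  vanish; then the condition on \<open>t\<close> says that \<open>t\<close> divides this label as well. This is what isolates
  a single multidegree in the end.
\<close>

lemma detector_support:
  "detector ts q \<noteq> 0 \<Longrightarrow> mon_lcm ts \<le> ds (length ts) ! q"
proof (induction ts arbitrary: q)
  case (Cons t ts)
  have t: "t \<le> sup (ds (Suc (length ts)) ! q) (mon_lcm ts)"
    and nz: "(\<Sum>p<length (ds (length ts)). detector ts p * d (length ts) p q) \<noteq> 0"
    using Cons.prems by (auto split: if_splits)
  obtain p where "detector ts p * d (length ts) p q \<noteq> 0"
    using nz by (meson sum.not_neutral_contains_not_neutral)
  then have "mon_lcm ts \<le> ds (length ts) ! p" "ds (length ts) ! p \<le> ds (Suc (length ts)) ! q"
    using Cons.IH graded[of "length ts"] by (auto simp: graded_scalars_def)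
  then have le: "mon_lcm ts \<le> ds (Suc (length ts)) ! q" by (rule order_trans)
  then have "t \<le> ds (Suc (length ts)) ! q" using t by (simp add: sup.absorb1)
  then show ?case using le unfolding mon_lcm_Cons by (simp only: le_sup_iff list.size add_0_right add_Suc_right)
qed simp

text \<open>
  A multigraded chain map from the Taylor complex on ordered lists over \<open>G\<close> to the resolution, up to
  homological degree \<open>n\<close>: the list \<open>ts\<close> is a basis element of multidegree \<open>mon_lcm ts\<close> with boundary the
  alternating sum of its faces.
\<close>

definition lifts :: "'n mon set \<Rightarrow> nat \<Rightarrow> ('n mon list \<Rightarrow> nat \<Rightarrow> 'k) \<Rightarrow> bool" where
  "lifts G n f \<longleftrightarrow> (\<Sum>p<length (ds 0). e p * f [] p) = 1 \<and>
     (\<forall>ts. length ts \<le> n \<longrightarrow> set ts \<subseteq> G \<longrightarrow> f ts \<in> strand (ds (length ts)) (mon_lcm ts) \<and>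
        (\<forall>x xs. ts = x # xs \<longrightarrow> boundary (length xs) (f ts) = alt_sum f ts))"

lemma boundary_diff: "boundary i (x - y) = boundary i x - boundary i y"
  by (simp add: fun_eq_iff apply_cols_def algebra_simps sum_subtractf)

lemma boundary_zero: "boundary i 0 = 0"
  by (simp add: fun_eq_iff apply_cols_def)

lemma strand_diff: "x \<in> strand as b \<Longrightarrow> y \<in> strand as b \<Longrightarrow> x - y \<in> strand as b"
  by (force simp: strand_def)

text \<open>
  The alternating sum over the faces is a cycle in the multidegree of the list, so exactness yields
  a preimage. At the bottom, exactness at \<open>F\<^sub>0\<close> applies because the multidegree lies in the ideal.
\<close>

lemma lift_exists:
  assumes f: "lifts G (length xs) f" and G: "\<And>g. g \<in> G \<Longrightarrow> xpow g \<in> I" and xs: "set (x # xs) \<subseteq> G"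
  shows "\<exists>w \<in> strand (ds (Suc (length xs))) (mon_lcm (x # xs)). boundary (length xs) w = alt_sum f (x # xs)"
proof -
  let ?b = "mon_lcm (x # xs)" and ?z = "alt_sum f (x # xs)"
  have face: "length (us @ vs) = length xs" "set (us @ vs) \<subseteq> G" "mon_lcm (us @ vs) \<le> ?b"
    if "x # xs = us @ y # vs" for us y vs
  proof -
    have *: "length (x # xs) = length (us @ y # vs)" "set (us @ vs) \<subseteq> set (x # xs)"
      unfolding that by auto
    then show "length (us @ vs) = length xs" "set (us @ vs) \<subseteq> G" using xs by auto
    show "mon_lcm (us @ vs) \<le> ?b" using *(2) by (rule mon_lcm_mono)
  qed
  have z: "?z \<in> strand (ds (length xs)) ?b"
  proof (rule alt_sum_mem)
    fix us y vs assume s: "x # xs = us @ y # vs"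
    have "f (us @ vs) \<in> strand (ds (length (us @ vs))) (mon_lcm (us @ vs))"
      using f face[OF s] unfolding lifts_def by (metis order_refl)
    then show "f (us @ vs) \<in> strand (ds (length xs)) ?b"
      using strand_mono[OF face(3)[OF s]] face(1)[OF s] by auto
  qed (auto simp: strand_diff zero_fun_def)
  show ?thesis
  proof (cases "length xs")
    case 0
    have "xpow ?b \<in> I" using up[of x ?b] G xs by auto
    then have "?z \<in> boundary 0 ` strand (ds (Suc 0)) ?b" using z 0 unfolding exact0[symmetric] by simp
    then show ?thesis using 0 by auto
  next
    case (Suc k)
    have "boundary k ?z = alt_sum (\<lambda>ys. boundary k (f ys)) (x # xs)"
      by (rule alt_sum_additive[where h = "boundary k"]) (simp_all only: boundary_zero boundary_diff)
    also have "\<dots> = alt_sum (alt_sum f) (x # xs)"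
    proof (rule alt_sum_cong)
      fix us y vs assume s: "x # xs = us @ y # vs"
      obtain a as where a: "us @ vs = a # as" "length as = k"
        using face(1)[OF s] Suc by (metis length_Suc_conv)
      then show "boundary k (f (us @ vs)) = alt_sum f (us @ vs)"
        using f face(1,2)[OF s] unfolding lifts_def by (metis order_refl)
    qed
    also have "\<dots> = (\<lambda>_. 0)" by (simp only: alt_sum_alt_sum zero_fun_def)
    finally have "?z \<in> boundary (Suc k) ` strand (ds (Suc (Suc k))) ?b"
      using z Suc unfolding exact[symmetric] by simp
    then show ?thesis using Suc by auto
  qed
qed

lemma lifts_exist:
  assumes G: "\<And>g. g \<in> G \<Longrightarrow> xpow g \<in> I"
  shows "\<exists>f. lifts G n f"
proof (induction n)
  case 0
  obtain w where "w \<in> strand (ds 0) 0" "(\<Sum>p<length (ds 0). e p * w p) = 1" using unit by blast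
  then have "lifts G 0 (\<lambda>_. w)" by (simp add: lifts_def)
  then show ?case by blast
next
  case (Suc n)
  then obtain f where f: "lifts G n f" by blast
  define g where "g = (\<lambda>ts. if length ts \<le> n then f ts else
     (SOME w. w \<in> strand (ds (Suc n)) (mon_lcm ts) \<and> boundary n w = alt_sum f ts))"
  have gf: "g ts = f ts" if "length ts \<le> n" for ts using that by (simp add: g_def)
  have alt: "alt_sum g ts = alt_sum f ts" if "length ts \<le> Suc n" for ts
    by (rule alt_sum_cong) (use that in \<open>auto intro!: gf\<close>)
  have new: "g (x # xs) \<in> strand (ds (Suc n)) (mon_lcm (x # xs)) \<and> boundary n (g (x # xs)) = alt_sum f (x # xs)"
    if "length xs = n" "set (x # xs) \<subseteq> G" for x xs
  proof -
    have "\<exists>w. w \<in> strand (ds (Suc n)) (mon_lcm (x # xs)) \<and> boundary n w = alt_sum f (x # xs)"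
      using lift_exists[of G xs f x] f G that by blast
    from someI_ex[OF this] show ?thesis using that by (simp add: g_def)
  qed
  have "g ts \<in> strand (ds (length ts)) (mon_lcm ts) \<and>
        (\<forall>x xs. ts = x # xs \<longrightarrow> boundary (length xs) (g ts) = alt_sum g ts)"
    if ts: "length ts \<le> Suc n" "set ts \<subseteq> G" for ts
  proof (cases "length ts \<le> n")
    case True
    then show ?thesis using f ts unfolding lifts_def alt[OF ts(1)] gf[OF True] by blast
  next
    case False
    then obtain x xs where "ts = x # xs" "length xs = n" using ts(1)
      by (metis le_SucE length_Suc_conv)
    then show ?thesis using new[of xs x] ts alt[OF ts(1)] by auto
  qed
  moreover have "(\<Sum>p<length (ds 0). e p * g [] p) = 1" using f by (simp add: lifts_def gf)
  ultimately have "lifts G (Suc n) g" unfolding lifts_def by blast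
  then show ?case by blast
qed

text \<open>
  Only the first face of the list contributes. On a face that omits another entry \<open>y\<close>, a nonzero value
  of the functional would make \<open>y\<close> divide the least common multiple of the remaining entries.
\<close>

lemma pairing_lift:
  assumes f: "lifts G n f"
  shows "length ts \<le> n \<Longrightarrow> set ts \<subseteq> G \<Longrightarrow> irredundant ts \<Longrightarrow> hit_below ts (mon_lcm ts) \<Longrightarrow>
    pairing ts (f ts) = 1"
proof (induction ts)
  case Nil
  then show ?case using f by (simp add: lifts_def pairing_def)
next
  case (Cons t ts)
  have F: "f us \<in> strand (ds (length us)) (mon_lcm us)"
    "us = x # xs \<Longrightarrow> boundary (length xs) (f us) = alt_sum f us"
    if "length us \<le> n" "set us \<subseteq> G" for us x xs
    using f that unfolding lifts_def by blast+
  have pairing_diff: "pairing ts (x - y) = pairing ts x - pairing ts y" for x y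
    by (simp add: pairing_def algebra_simps sum_subtractf)
  have "pairing ts (alt_sum (\<lambda>ys. f (t # ys)) ts) = alt_sum (\<lambda>ys. pairing ts (f (t # ys))) ts"
    by (rule alt_sum_additive[where h = "pairing ts"]) (simp add: pairing_def, rule pairing_diff)
  also have "\<dots> = 0"
  proof (rule alt_sum_zero)
    fix us y vs assume s: "ts = us @ y # vs"
    let ?r = "t # us @ vs"
    have len: "length ?r = length ts" by (simp add: s)
    have r: "f ?r \<in> strand (ds (length ts)) (mon_lcm ?r)"
      using F(1)[of ?r] Cons.prems(1,2) s unfolding len by auto
    have "detector ts p * f ?r p = 0" for p
    proof (rule ccontr)
      assume "detector ts p * f ?r p \<noteq> 0"
      then have "mon_lcm ts \<le> ds (length ts) ! p" "ds (length ts) ! p \<le> mon_lcm ?r"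
        using detector_support strandD[OF r] by auto
      moreover have "y \<le> mon_lcm ts" by (rule le_mon_lcm) (simp add: s)
      ultimately have "y \<le> mon_lcm ?r" using order_trans by blast
      then show False using irredundant_Cons(3)[OF Cons.prems(3) s] by blast
    qed
    then show "pairing ts (f ?r) = 0" unfolding pairing_def by simp
  qed
  finally have faces: "pairing ts (alt_sum (\<lambda>ys. f (t # ys)) ts) = 0" .
  have "mon_lcm ts \<le> mon_lcm (t # ts)" by simp
  then have "hit_below (t # ts) (mon_lcm ts)" using Cons.prems(4) hit_below_mono by blast
  moreover have "\<not> t \<le> sup (mon_lcm ts) (mon_lcm ts)"
    using irredundant_Cons(2)[OF Cons.prems(3)] by (simp only: sup.idem not_False_eq_True)
  ultimately have "hit_below ts (mon_lcm ts)" by (rule hit_below_Cons)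
  moreover have "length ts \<le> n" "set ts \<subseteq> G" using Cons.prems(1,2) by auto
  ultimately have IH: "pairing ts (f ts) = 1"
    using Cons.IH irredundant_Cons(1)[OF Cons.prems(3)] by blast
  have "f (t # ts) \<in> strand (ds (Suc (length ts))) (mon_lcm (t # ts))"
    using F(1)[OF Cons.prems(1,2)] by simp
  from pairing_Cons[OF pairing_cocycle Cons.prems(4) this]
  have "pairing (t # ts) (f (t # ts)) = pairing ts (boundary (length ts) (f (t # ts)))" .
  also have "boundary (length ts) (f (t # ts)) = f ts - alt_sum (\<lambda>ys. f (t # ys)) ts"
    using F(2)[of "t # ts"] Cons.prems(1,2) by simp
  finally show ?case unfolding pairing_diff faces IH by simp
qed

text \<open>
  The image of \<open>ts\<close> under the comparison map only involves labels dividing the least common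
  multiple, and the functional only sees labels divisible by it.
\<close>

lemma lcm_is_label:
  assumes "irredundant ts" "hit_below ts (mon_lcm ts)" "\<And>t. t \<in> set ts \<Longrightarrow> xpow t \<in> I"
  shows "mon_lcm ts \<in> set (ds (length ts))"
proof -
  obtain f where f: "lifts (set ts) (length ts) f" using lifts_exist assms(3) by blast
  have "pairing ts (f ts) = 1" by (rule pairing_lift[OF f]) (use assms in auto)
  then have "(\<Sum>p<length (ds (length ts)). detector ts p * f ts p) \<noteq> 0" by (simp add: pairing_def)
  then obtain p where p: "detector ts p * f ts p \<noteq> 0"
    by (meson sum.not_neutral_contains_not_neutral)
  have "f ts \<in> strand (ds (length ts)) (mon_lcm ts)" using f unfolding lifts_def by blast
  then have "p < length (ds (length ts))" "ds (length ts) ! p \<le> mon_lcm ts"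
    using p strandD by auto
  moreover have "mon_lcm ts \<le> ds (length ts) ! p" using p detector_support by simp
  ultimately show ?thesis by (metis antisym nth_mem)
qed

end

text \<open>
  The assumption \<open>unit\<close> comes from a preimage of the class of \<open>1\<close>: as a proper monomial ideal has no
  component in multidegree \<open>0\<close>, the component of the preimage in that multidegree maps to \<open>1\<close> exactly.
\<close>

lemma free_resolution_strands:
  fixes I :: "('n::finite, 'k::field) mpoly set"
  assumes I: "squarefree_monomial_ideal I" and proper: "xpow 0 \<notin> I" and res: "free_resolution I ds D E"
  shows "strand_resolution I ds (\<lambda>i. scalars (ds i) (ds (Suc i)) (D i)) (scalars [0] (ds 0) E 0)"
proof
  have gr: "graded_map [0] (ds 0) E" "\<And>i. graded_map (ds i) (ds (i + 1)) (D i)"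
    using res by (auto simp: free_resolution_def)
  note res' = res[unfolded free_resolution_iff_strands[of I ds E D, OF I gr]]
  show "xpow c \<in> I" if "xpow b \<in> I" "b \<le> c" for b c
    using that unfolding xpow_in_iff_gens[OF I] using order_trans by blast
  show "graded_scalars (ds i) (ds (Suc i)) (scalars (ds i) (ds (Suc i)) (D i))" for i by simp
  show "{x \<in> strand (ds 0) b. xpow b \<in> I \<or> (\<Sum>p<length (ds 0). scalars [0] (ds 0) E 0 p * x p) = 0} =
         apply_cols (length (ds (Suc 0))) (scalars (ds 0) (ds (Suc 0)) (D 0)) ` strand (ds (Suc 0)) b" for b
    using res' by (simp add: apply_cols_def[of "length (ds 0)"])
  show "{x \<in> strand (ds (Suc i)) b. apply_cols (length (ds (Suc i))) (scalars (ds i) (ds (Suc i)) (D i)) x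
           = (\<lambda>_. 0)} =
         apply_cols (length (ds (Suc (Suc i)))) (scalars (ds (Suc i)) (ds (Suc (Suc i))) (D (Suc i)))
           ` strand (ds (Suc (Suc i))) b" for i b
    using res' by simp
  obtain v where v: "v \<in> carrier_vec (length (ds 0))" "1 - (E *\<^sub>v v) $ 0 \<in> I"
    using res' by blast
  have "coef (1 - (E *\<^sub>v v) $ 0) 0 = 0"
    using mem_monomial_ideal[OF I, of "1 - (E *\<^sub>v v) $ 0"] v(2) proper by blast
  then have "hcomp [0] (E *\<^sub>v v) 0 0 = 1" by (simp add: lookup_minus hcomp_def lookup_one)
  then show "\<exists>w\<in>strand (ds 0) 0. (\<Sum>p<length (ds 0). scalars [0] (ds 0) E 0 p * w p) = 1"
    unfolding hcomp_mult_mat_vec[OF gr(1) v(1)] apply_cols_def by (intro bexI) auto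
qed

lemma well_ordered_cover_hits:
  assumes "well_ordered_cover I ts" "n \<in> gens I"
  shows "hits ts n"
proof (cases "n \<in> set ts")
  case True
  then obtain us vs where "ts = us @ n # vs" by (meson split_list)
  then show ?thesis by (simp add: hits_append)
next
  case False
  then obtain j where j: "j + 1 < length ts" "ts ! j \<le> mon_lcm (n # drop (j + 1) ts)"
    using assms unfolding well_ordered_cover_def by blast
  then have "hits (take j ts @ ts ! j # drop (Suc j) ts) n" by (intro hits_append) simp
  then show ?thesis using j(1) by (simp add: id_take_nth_drop[symmetric])
qed

text \<open>
  The multidegree is found in every resolution, so the value of \<open>betti\<close> is nonzero whichever minimal
  resolution is chosen; that there is one guarantees that the choice is meaningful.
\<close>

lemma betti_nonzero:
  fixes I :: "('n::finite, 'k::field) mpoly set"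
  assumes I: "squarefree_monomial_ideal I" and proper: "xpow 0 \<notin> I"
    and ts: "well_ordered_cover (ideal_below I (mon_lcm ts)) ts"
  shows "betti I (length ts) (mon_lcm ts) \<noteq> 0"
proof -
  let ?J = "ideal_below I (mon_lcm ts)"
  have cov: "minimal_cover ?J (set ts)" "distinct ts" using ts by (auto simp: well_ordered_cover_def)
  have irr: "irredundant ts"
    by (rule minimal_cover_list_irredundant[OF ideal_below_squarefree[OF I] cov])
  have gens: "t \<in> gens I" if "t \<in> set ts" for t
    using cov(1) that by (auto simp: minimal_cover_def cover_def gens_ideal_below)
  have "count_list (ds (length ts)) (mon_lcm ts) \<noteq> 0"
    if "minimal_free_resolution I ds D E" for ds D E
  proof -
    have "free_resolution I ds D E" using that by (simp add: minimal_free_resolution_def)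
    then interpret strand_resolution I ds "\<lambda>i. scalars (ds i) (ds (Suc i)) (D i)"
      "scalars [0] (ds 0) E 0"
      by (rule free_resolution_strands[OF I proper])
    have "hit_below ts (mon_lcm ts)"
      unfolding hit_below_def
    proof (intro allI impI)
      fix b assume b: "b \<le> mon_lcm ts" "xpow b \<in> I"
      then obtain n where n: "n \<in> gens I" "n \<le> b" using xpow_in_iff_gens[OF I] by blast
      then have "n \<in> gens ?J" using b(1) by (auto simp: gens_ideal_below)
      then show "hits ts b" using well_ordered_cover_hits[OF ts] hits_mono n(2) by blast
    qed
    then have "mon_lcm ts \<in> set (ds (length ts))"
      using lcm_is_label[OF irr] gens by (auto simp: gens_def)
    then show ?thesis by (simp add: count_list_0_iff)
  qed
  moreover have "\<exists>b ds D E. minimal_free_resolution I ds D E \<and> b = count_list (ds (length ts)) (mon_lcm ts)"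
    using minimal_free_resolution_exists[OF I proper] by blast
  ultimately show ?thesis
    unfolding betti_def
    by (smt (verit, ccfv_SIG) someI_ex)
qed

section \<open>The proposition\<close>

theorem proposition4p5:
  fixes I :: "('n::finite, 'k::field) mpoly set"
    and ms :: "'n mon list"
    and a :: nat
    and m m' :: "'n mon"
  assumes "squarefree_monomial_ideal I"
    and "well_ordered_cover I ms"
    and "1 \<le> a" and "a \<le> length ms - 1"
    and "m = mon_lcm (take a ms)"
    and "m' = mon_lcm (drop a ms)"
  shows "minimal_cover (ideal_below I m) (set (take a ms))
       \<and> well_ordered_cover (ideal_below I m') (drop a ms)
       \<and> betti I (length ms - a) m' \<noteq> 0"
proof -
  have cov: "minimal_cover I (set ms)" "distinct ms"
    using assms(2) by (auto simp: well_ordered_cover_def)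
  have tail: "well_ordered_cover (ideal_below I m') (drop a ms)"
    unfolding assms(6) by (rule well_ordered_cover_drop[OF assms(1,2)])
  have "xpow 0 \<notin> I" using proper_if_two_gens[OF cov] assms(3,4) by simp
  then have "betti I (length (drop a ms)) (mon_lcm (drop a ms)) \<noteq> 0"
    using betti_nonzero[OF assms(1)] tail assms(6) by blast
  then show ?thesis
    using minimal_cover_sublist[OF cov(1) set_take_subset[of a]] tail assms(5,6) by simp
qed

end
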